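(* Let $d=2$, let $Q_1,Q_2,Q_3,Q_4$ be the four quadrants in the plane, in clockwise order, and let $W=(W_t)_{0\le t\le 1}$ be a planar Brownian motion started at the origin. Let $$\mu(Q_i):=\int_0^1\mathbf{1}_{\{W_t\in Q_i\}}\,dt$$ be the time spent in $Q_i$ up to time $1$. Then for each $k\in\{1,2,3,4\}$, the random variable $$\mathbb{P}\bigl(W_1\in Q_k \mid \mu(Q_i):1\le i\le 4\bigr)$$ is not almost surely equal to $\mu(Q_k)$.
   Context: The conditional probability is given the $\sigma$-field generated by the four random variables $\mu(Q_1),\dots,\mu(Q_4)$. *)

theory Defs
  imports "HOL-Probability.Probability"
begin

text \<open>
  Standard Brownian motion on the time interval $[0,1]$ in a Euclidean space, started at the
  origin. The increment over $[s,t]$ is centred Gaussian with covariance $(t-s)I$, that is, its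
  coordinates are independent centred normals with standard deviation $\sqrt{t-s}$. Every path is
  continuous; the starting point is prescribed almost surely.
\<close>

locale brownian_motion = prob_space M for M :: "'w measure" +
  fixes W :: "real \<Rightarrow> 'w \<Rightarrow> 'v::euclidean_space"
  assumes measurable_W: "t \<in> {0..1} \<Longrightarrow> W t \<in> borel_measurable M"
    and start: "AE \<omega> in M. W 0 \<omega> = 0"
    and continuous_paths: "\<omega> \<in> space M \<Longrightarrow> continuous_on {0..1} (\<lambda>t. W t \<omega>)"
    and gaussian_increments:
      "0 \<le> s \<Longrightarrow> s < t \<Longrightarrow> t \<le> 1 \<Longrightarrow>
        distributed M lborel (\<lambda>\<omega>. W t \<omega> - W s \<omega>)
          (\<lambda>x. ennreal (\<Prod>b\<in>Basis. normal_density 0 (sqrt (t - s)) (x \<bullet> b)))"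
    and independent_increments:
      "(\<And>i. i \<le> n \<Longrightarrow> \<tau> i \<in> {0..1}) \<Longrightarrow> mono_on {..n} \<tau> \<Longrightarrow>
        indep_vars (\<lambda>_. borel) (\<lambda>i \<omega>. W (\<tau> (Suc i)) \<omega> - W (\<tau> i) \<omega>) {..<n::nat}"

text \<open>
  The open quadrants in clockwise order, starting from the positive one. Only the indices
  1 to 4 are meaningful.
\<close>

definition quadrant :: "nat \<Rightarrow> (real \<times> real) set" where
  "quadrant k =
    (if k = 1 then {(x, y). 0 < x \<and> 0 < y}
     else if k = 2 then {(x, y). 0 < x \<and> y < 0}
     else if k = 3 then {(x, y). x < 0 \<and> y < 0}
     else if k = 4 then {(x, y). x < 0 \<and> 0 < y}
     else {})"

definition occupation_time :: "(real \<Rightarrow> 'w \<Rightarrow> 'v) \<Rightarrow> 'v set \<Rightarrow> 'w \<Rightarrow> real" where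
  "occupation_time W A \<omega> = (LBINT t:{0..1}. indicat_real A (W t \<omega>))"

definition generated_algebra ::
  "'w measure \<Rightarrow> 'i set \<Rightarrow> ('i \<Rightarrow> 'w \<Rightarrow> real) \<Rightarrow> 'w measure" where
  "generated_algebra M I X =
    sigma (space M) {X i -` B \<inter> space M |i B. i \<in> I \<and> B \<in> sets borel}"

definition cond_prob_event :: "'w measure \<Rightarrow> 'w measure \<Rightarrow> 'w set \<Rightarrow> 'w \<Rightarrow> real" where
  "cond_prob_event M F A = real_cond_exp M F (indicat_real A)"

end

theory Submission imports Defs begin

text \<open>
  Write $a_t$, $b_t$ for the signs of the two coordinates of $W_t$, and $A = \int_0^1 a_t\,dt$,
  $B = \int_0^1 b_t\,dt$; almost surely these are functions of the $\mu(Q_i)$. Up to null sets,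
  $4\cdot 1_{Q_k}(W_t) = (1 + \varepsilon a_t)(1 + \delta b_t)$ with signs $\varepsilon, \delta$.
  The two coordinates are independent with the same law and $E[A] = 0$, so
  $4 E[1_{Q_k}(W_t) A B] = \varepsilon\delta\, m(t)^2$ with $m(t) = E[a_t A]$.
  Testing the claimed identity against $AB$ would therefore give $m(1)^2 = \int_0^1 m(t)^2 dt$.
  But $m(1) = \int_0^1 m(t)\,dt = 1/2$, so equality in Jensen's inequality would force $m$ to be
  almost everywhere constant, whereas $m(t) \to 0$ as $t \to 0$. The values of $m$ come from
  $E[a_s a_t] = \varrho(s/t)$ for $s < t$, where $\varrho(v) + \varrho(1 - v) = 1$ by exchanging two
  independent standard normal variables, and $\varrho(v) \to 0$ as $v \to 0$.
\<close>

text \<open>The mixed product AB is the simplest test function that detects the failure. Against the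
  constant 1 both sides give 1/4, and against A alone they give, after multiplication by 4, the
  values \<epsilon> m(1) and \<epsilon> \<integral> m(t) dt, which agree. Only the product brings in
  m squared, and with it strict convexity. The two values 1/2 come from symmetry. By reflection
  \<rho> has average 1/2 on the unit interval. By scaling, the integral of \<rho>(s/t) over s < t is
  then t/2, and the triangle s < t carries half of the integral of E[a_s a_t] over the unit square.
  The main obstacle is that A and B depend on whole paths, while the hypotheses speak of increments
  at finitely many times. Fubini removes the time integrals one at a time, so that independence is
  used only at two times per coordinate.\<close>

section \<open>Sign correlations of Gaussian variables\<close>

definition std_normal :: "real measure" where
  "std_normal = density lborel std_normal_density"

text \<open>The function \<rho> of the overview: the sign correlation of two standard normals whose
  correlation is \<open>sqrt v\<close>. Sheppard's formula gives it the closed form (2/pi) arcsin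
  (\<open>sqrt v\<close>) on the unit interval; the integral form makes the symmetry under v to 1 -
  v visible.\<close>

definition sign_corr :: "real \<Rightarrow> real" where
  "sign_corr v =
    (\<integral>x. sgn (fst x) * sgn (sqrt v * fst x + sqrt (1 - v) * snd x) \<partial>(std_normal \<Otimes>\<^sub>M std_normal))"

lemma sets_std_normal [simp, measurable_cong]: "sets std_normal = sets borel"
  by (simp add: std_normal_def)

lemma space_std_normal [simp]: "space std_normal = UNIV"
  by (simp add: std_normal_def)

lemma prob_space_std_normal: "prob_space std_normal"
  unfolding std_normal_def by (rule prob_space_normal_density) simp

interpretation std_normal: prob_space std_normal
  by (rule prob_space_std_normal)

interpretation std_normal_pair: pair_prob_space std_normal std_normal ..

lemma (in prob_space) integrable_bounded_real:
  fixes f :: "'a \<Rightarrow> real"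
  assumes "f \<in> borel_measurable M" "\<And>x. x \<in> space M \<Longrightarrow> \<bar>f x\<bar> \<le> c"
  shows "integrable M f"
  using assms by (intro integrable_const_bound[where B=c]) auto

lemma abs_sgn_le_1: "\<bar>sgn (x::real)\<bar> \<le> 1"
  by (simp add: sgn_if)

lemma AE_std_normal_neq_0: "AE x in std_normal. x \<noteq> 0"
  unfolding std_normal_def using AE_lborel_singleton[of 0]
  by (subst AE_density) (auto elim: eventually_mono)

lemma integral_sgn_std_normal: "(\<integral>x. sgn x \<partial>std_normal) = 0"
proof -
  have "(\<integral>x. sgn x \<partial>std_normal) = (\<integral>x. std_normal_density x * sgn x \<partial>lborel)"
    unfolding std_normal_def by (subst integral_density) auto
  also have "\<dots> = (\<integral>x. std_normal_density (0 + - 1 * x) * sgn (0 + - 1 * x) \<partial>lborel)"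
    by (subst lborel_integral_real_affine[where c="-1" and t=0]) auto
  also have "\<dots> = - (\<integral>x. std_normal_density x * sgn x \<partial>lborel)"
    by (simp add: normal_density_def sgn_minus)
  also have "(\<integral>x. std_normal_density x * sgn x \<partial>lborel) = (\<integral>x. sgn x \<partial>std_normal)"
    unfolding std_normal_def by (subst integral_density) auto
  finally show ?thesis by simp
qed

lemma integral_sgn_mult_sgn_std_normal:
  "(\<integral>x. sgn (fst x) * sgn (snd x) \<partial>(std_normal \<Otimes>\<^sub>M std_normal)) = 0"
proof -
  have "(\<integral>x. sgn (fst x) * sgn (snd x) \<partial>(std_normal \<Otimes>\<^sub>M std_normal))
      = (\<integral>x. (\<integral>y. sgn x * sgn y \<partial>std_normal) \<partial>std_normal)"
    by (subst std_normal_pair.integral_fst'[symmetric], rule std_normal_pair.integrable_bounded_real[where c=1])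
       (auto simp: abs_mult intro!: mult_le_one abs_sgn_le_1)
  also have "\<dots> = 0" by (simp add: integral_sgn_std_normal)
  finally show ?thesis .
qed

lemma AE_std_normal_pair_neq_0:
  "AE x in std_normal \<Otimes>\<^sub>M std_normal. fst x \<noteq> 0 \<and> snd x \<noteq> 0"
proof (rule std_normal_pair.AE_pair_measure)
  show "AE x in std_normal. AE y in std_normal. fst (x, y) \<noteq> 0 \<and> snd (x, y) \<noteq> 0"
    using AE_std_normal_neq_0
  proof eventually_elim
    case (elim x)
    show ?case using AE_std_normal_neq_0 by eventually_elim (use elim in simp)
  qed
qed measurable

text \<open>For nonzero p and q, (sgn p + sgn q) sgn(p + q) = 1 + sgn p sgn q: both sides are 2 for
  equal signs and 0 for opposite ones. Take p and q to be the two Gaussian summands, which are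
  almost surely nonzero for v strictly inside the unit interval. Exchanging the variables makes the
  second term \<open>sign_corr (1 - v)\<close>, and sgn p sgn q has mean zero.\<close>

lemma sign_corr_add_reflect:
  assumes "0 < v" "v < 1"
  shows "sign_corr v + sign_corr (1 - v) = 1"
proof -
  let ?N = "std_normal \<Otimes>\<^sub>M std_normal"
  let ?p = "\<lambda>x. sqrt v * fst x" and ?q = "\<lambda>x. sqrt (1 - v) * snd x"
  have int: "integrable ?N (\<lambda>x. sgn (fst x) * sgn (?p x + ?q x))"
    "integrable ?N (\<lambda>x. sgn (snd x) * sgn (?p x + ?q x))"
    "integrable ?N (\<lambda>x. sgn (fst x) * sgn (snd x))"
    by (auto intro!: std_normal_pair.integrable_bounded_real[where c=1] mult_le_one abs_sgn_le_1 simp: abs_mult)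
  have "sign_corr (1 - v) = (\<integral>x. sgn (snd x) * sgn (?p x + ?q x) \<partial>?N)"
    unfolding sign_corr_def
    by (subst std_normal_pair.integral_product_swap[symmetric])
       (auto simp: split_def add.commute intro!: Bochner_Integration.integral_cong)
  hence "sign_corr v + sign_corr (1 - v)
      = (\<integral>x. sgn (fst x) * sgn (?p x + ?q x) + sgn (snd x) * sgn (?p x + ?q x) \<partial>?N)"
    unfolding sign_corr_def by (simp add: int)
  also have "\<dots> = (\<integral>x. 1 + sgn (fst x) * sgn (snd x) \<partial>?N)"
  proof (rule integral_cong_AE)
    show "AE x in ?N. sgn (fst x) * sgn (?p x + ?q x) + sgn (snd x) * sgn (?p x + ?q x)
        = 1 + sgn (fst x) * sgn (snd x)"
      using AE_std_normal_pair_neq_0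
    proof eventually_elim
      case (elim x)
      have "sgn (?p x) = sgn (fst x)" "sgn (?q x) = sgn (snd x)"
        using assms by (simp_all add: sgn_mult)
      moreover have "sgn a * sgn (a + b) + sgn b * sgn (a + b) = 1 + sgn a * sgn b"
        if "a \<noteq> 0" "b \<noteq> 0" for a b :: real
        using that by (auto simp: sgn_if)
      ultimately show ?case using elim assms by (metis mult_eq_0_iff order_less_irrefl
          diff_gt_0_iff_gt real_sqrt_gt_0_iff)
    qed
  qed measurable
  also have "\<dots> = 1"
    using int(3) by (simp add: integral_sgn_mult_sgn_std_normal std_normal_pair.prob_space)
  finally show ?thesis .
qed

lemma sign_corr_bounded: "\<bar>sign_corr v\<bar> \<le> 1"
proof -
  have "norm (sign_corr v) \<le> (\<integral>x. 1 \<partial>(std_normal \<Otimes>\<^sub>M std_normal))"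
    unfolding sign_corr_def
    by (rule Bochner_Integration.integral_norm_bound_integral)
       (auto intro!: std_normal_pair.integrable_bounded_real[where c=1] mult_le_one abs_sgn_le_1 simp: abs_mult)
  thus ?thesis by (simp add: std_normal_pair.prob_space)
qed

lemma measurable_sign_corr [measurable]: "sign_corr \<in> borel_measurable borel"
  unfolding sign_corr_def by measurable

text \<open>In the limit only the second variable survives in the sum. It is almost surely nonzero,
  where \<open>sgn\<close> is continuous, so dominated convergence leads to the mean of a product of
  independent centred signs.\<close>

lemma sign_corr_tendsto_0:
  assumes "v \<longlonglongrightarrow> 0"
  shows "(\<lambda>n. sign_corr (v n)) \<longlonglongrightarrow> 0"
proof -
  let ?N = "std_normal \<Otimes>\<^sub>M std_normal"
  have "(\<lambda>n. sign_corr (v n)) \<longlonglongrightarrow> (\<integral>x. sgn (fst x) * sgn (snd x) \<partial>?N)"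
    unfolding sign_corr_def
  proof (rule integral_dominated_convergence[where w="\<lambda>_. 1"])
    show "AE x in ?N. (\<lambda>n. sgn (fst x) * sgn (sqrt (v n) * fst x + sqrt (1 - v n) * snd x))
        \<longlonglongrightarrow> sgn (fst x) * sgn (snd x)"
      using AE_std_normal_pair_neq_0
    proof eventually_elim
      case (elim x)
      have "(\<lambda>n. sqrt (v n) * fst x + sqrt (1 - v n) * snd x)
          \<longlonglongrightarrow> sqrt 0 * fst x + sqrt (1 - 0) * snd x"
        by (intro tendsto_intros assms)
      hence "(\<lambda>n. sgn (sqrt (v n) * fst x + sqrt (1 - v n) * snd x)) \<longlonglongrightarrow> sgn (snd x)"
        using elim by (auto intro: tendsto_sgn)
      thus ?case by (intro tendsto_mult tendsto_const)
    qed
  qed (auto intro!: mult_le_one abs_sgn_le_1 simp: abs_mult)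
  thus ?thesis by (simp add: integral_sgn_mult_sgn_std_normal)
qed

abbreviation unit_lborel :: "real measure" where
  "unit_lborel \<equiv> restrict_space lborel {0..1}"

text \<open>The substitution v to 1 - v preserves the unit interval, so twice the integral is the
  integral of \<open>sign_corr v + sign_corr (1 - v)\<close>, which is 1 off the two
  endpoints.\<close>

lemma integral_sign_corr: "(\<integral>v. sign_corr v \<partial>unit_lborel) = 1 / 2"
proof -
  interpret U: prob_space unit_lborel
    by (rule prob_spaceI) (simp add: emeasure_restrict_space space_restrict_space)
  have m: "sign_corr \<in> borel_measurable unit_lborel" "(\<lambda>v. sign_corr (1 - v)) \<in> borel_measurable unit_lborel"
    by (auto intro!: measurable_restrict_space1)
  have i: "integrable unit_lborel sign_corr" "integrable unit_lborel (\<lambda>v. sign_corr (1 - v))"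
    using m by (auto intro!: U.integrable_bounded_real[where c=1] sign_corr_bounded)
  have "(\<integral>v. sign_corr v \<partial>unit_lborel) = (\<integral>v. indicator {0..1} v *\<^sub>R sign_corr v \<partial>lborel)"
    by (subst integral_restrict_space) auto
  also have "\<dots> = (\<integral>v. indicator {0..1} (1 + -1 * v) *\<^sub>R sign_corr (1 + -1 * v) \<partial>lborel)"
    by (subst lborel_integral_real_affine[where c="-1" and t=1]) auto
  also have "\<dots> = (\<integral>v. indicator {0..1} v *\<^sub>R sign_corr (1 - v) \<partial>lborel)"
    by (rule Bochner_Integration.integral_cong) (auto simp: indicator_def)
  also have "\<dots> = (\<integral>v. sign_corr (1 - v) \<partial>unit_lborel)"
    by (subst integral_restrict_space) auto
  finally have "2 * (\<integral>v. sign_corr v \<partial>unit_lborel) = (\<integral>v. sign_corr v + sign_corr (1 - v) \<partial>unit_lborel)"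
    using i by simp
  also have "\<dots> = (\<integral>v. 1 \<partial>unit_lborel)"
  proof (rule integral_cong_AE)
    have "AE v in lborel. v \<noteq> (0::real)" "AE v in lborel. v \<noteq> (1::real)"
      by (rule AE_lborel_singleton)+
    hence "AE v in lborel. v \<in> {0..1} \<longrightarrow> sign_corr v + sign_corr (1 - v) = 1"
      by eventually_elim (auto intro!: sign_corr_add_reflect)
    thus "AE v in unit_lborel. sign_corr v + sign_corr (1 - v) = 1"
      by (subst AE_restrict_space_iff) auto
  qed (use m in auto)
  finally show ?thesis by (simp add: measure_restrict_space)
qed

section \<open>Coordinates of planar Brownian motion and their independence\<close>

text \<open>Indexing coordinates by \<open>bool\<close> lets pairs (increment number, coordinate)
  index one independent family, which can be split by coordinate afterwards.\<close>

definition coord :: "bool \<Rightarrow> real \<times> real \<Rightarrow> real" where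
  "coord c p = (if c then fst p else snd p)"

lemma measurable_coord [measurable]: "coord c \<in> borel_measurable borel"
  unfolding coord_def by (cases c) (simp_all add: borel_prod[symmetric])

lemma coord_diff: "coord c (p - q) = coord c p - coord c q"
  by (simp add: coord_def)

lemma coord_sum: "coord c (\<Sum>i\<in>I. f i) = (\<Sum>i\<in>I. coord c (f i))"
  by (simp add: coord_def fst_sum snd_sum)

lemma distr_pair_snd_prob:
  assumes "prob_space M" "prob_space N"
  shows "distr (M \<Otimes>\<^sub>M N) N snd = N"
proof -
  interpret M: prob_space M by fact
  interpret N: prob_space N by fact
  interpret MN: pair_prob_space M N ..
  show ?thesis
  proof (rule measure_eqI)
    fix A assume "A \<in> sets (distr (M \<Otimes>\<^sub>M N) N snd)"
    hence A: "A \<in> sets N" by simp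
    hence "snd -` A \<inter> space (M \<Otimes>\<^sub>M N) = space M \<times> A"
      by (auto simp: space_pair_measure dest: sets.sets_into_space)
    thus "emeasure (distr (M \<Otimes>\<^sub>M N) N snd) A = emeasure N A"
      using A by (simp add: emeasure_distr N.emeasure_pair_measure_Times M.emeasure_space_1)
  qed simp
qed

locale planar_brownian_motion = brownian_motion M W
  for M :: "'w measure" and W :: "real \<Rightarrow> 'w \<Rightarrow> real \<times> real"
begin

lemma distr_increment:
  assumes "0 \<le> s" "s < t" "t \<le> 1"
  shows "distr M (borel \<Otimes>\<^sub>M borel) (\<lambda>\<omega>. W t \<omega> - W s \<omega>)
    = density lborel (normal_density 0 (sqrt (t - s))) \<Otimes>\<^sub>M density lborel (normal_density 0 (sqrt (t - s)))"
proof -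
  let ?f = "normal_density 0 (sqrt (t - s))"
  interpret N: prob_space "density lborel ?f"
    by (rule prob_space_normal_density) (use assms in simp)
  have "distr M (borel \<Otimes>\<^sub>M borel) (\<lambda>\<omega>. W t \<omega> - W s \<omega>) = distr M lborel (\<lambda>\<omega>. W t \<omega> - W s \<omega>)"
    by (intro distr_cong) (simp_all only: borel_prod sets_lborel)
  also have "\<dots> = density lborel (\<lambda>x. ennreal (\<Prod>b\<in>Basis. ?f (x \<bullet> b)))"
    using gaussian_increments[OF assms] by (rule distributed_distr_eq_density)
  \<comment> \<open>The basis of the plane is the disjoint union of the two coordinate directions,
    so the product over \<open>Basis\<close> has exactly two factors.\<close>
  also have "\<dots> = density (lborel \<Otimes>\<^sub>M lborel) (\<lambda>(x, y). ennreal (?f x) * ennreal (?f y))"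
    by (simp add: lborel_prod split_beta' Basis_prod_def prod.union_disjoint
        prod.reindex inj_on_def ennreal_mult' disjoint_iff inner_prod_def mult.commute)
  also have "\<dots> = density lborel ?f \<Otimes>\<^sub>M density lborel ?f"
    by (rule pair_measure_density[symmetric]) (auto intro: lborel.sigma_finite_measure_axioms N.sigma_finite_measure_axioms)
  finally show ?thesis .
qed

lemma distr_coord_increment:
  assumes "0 \<le> s" "s < t" "t \<le> 1"
  shows "distr M borel (\<lambda>\<omega>. coord c (W t \<omega> - W s \<omega>)) = density lborel (normal_density 0 (sqrt (t - s)))"
proof -
  let ?N = "density lborel (normal_density 0 (sqrt (t - s)))"
  interpret N: prob_space ?N
    by (rule prob_space_normal_density) (use assms in simp)
  interpret NN: pair_prob_space ?N ?N ..
  have [measurable]: "W t \<in> borel_measurable M" "W s \<in> borel_measurable M"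
    using assms by (auto intro: measurable_W)
  have "distr M borel (\<lambda>\<omega>. coord c (W t \<omega> - W s \<omega>))
      = distr (distr M (borel \<Otimes>\<^sub>M borel) (\<lambda>\<omega>. W t \<omega> - W s \<omega>)) borel (coord c)"
    by (subst distr_distr) (auto simp: borel_prod comp_def)
  also have "\<dots> = distr (?N \<Otimes>\<^sub>M ?N) ?N (coord c)"
    by (subst distr_increment[OF assms]) (rule distr_cong, auto)
  also have "\<dots> = ?N"
  proof (cases c)
    case True
    hence "coord c = fst" by (auto simp: coord_def)
    thus ?thesis by (simp add: N.distr_pair_fst)
  next
    case False
    hence "coord c = snd" by (auto simp: coord_def)
    thus ?thesis by (simp add: distr_pair_snd_prob N.prob_space_axioms)
  qed
  finally show ?thesis .
qed

lemma indep_var_coord_increment: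
  assumes "0 \<le> s" "s < t" "t \<le> 1"
  shows "indep_var borel (\<lambda>\<omega>. fst (W t \<omega> - W s \<omega>)) borel (\<lambda>\<omega>. snd (W t \<omega> - W s \<omega>))"
proof -
  have [measurable]: "W t \<in> borel_measurable M" "W s \<in> borel_measurable M"
    using assms by (auto intro: measurable_W)
  have rv: "random_variable borel (\<lambda>\<omega>. coord c (W t \<omega> - W s \<omega>))" for c
    by measurable
  show ?thesis
    using rv[of True] rv[of False] distr_increment[OF assms]
      distr_coord_increment[OF assms, of True] distr_coord_increment[OF assms, of False]
    by (simp add: indep_var_distribution_eq coord_def del: fst_diff snd_diff)
qed

text \<open>The degenerate case \<open>s = t\<close> is included because a sorted grid may repeat a
  time. The increment is then 0, and every probability involved is 0 or 1.\<close>

lemma prob_increment_Times: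
  assumes "0 \<le> s" "s \<le> t" "t \<le> 1" "A \<in> sets borel" "B \<in> sets borel"
  shows "prob ((\<lambda>\<omega>. W t \<omega> - W s \<omega>) -` (A \<times> B) \<inter> space M)
    = prob ((\<lambda>\<omega>. fst (W t \<omega> - W s \<omega>)) -` A \<inter> space M)
      * prob ((\<lambda>\<omega>. snd (W t \<omega> - W s \<omega>)) -` B \<inter> space M)"
proof (cases "s = t")
  case True
  thus ?thesis using prob_space by (cases "0 \<in> A"; cases "0 \<in> B") (auto simp: zero_prod_def)
next
  case False
  with indep_varD[OF indep_var_coord_increment[of s t] assms(4,5)] assms show ?thesis
    by (simp del: fst_diff snd_diff)
qed

text \<open>A product event for the scalar increments is an intersection over i of rectangle events
  for the planar increments. Independence over time factorises the intersection, and the Gaussian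
  density factorises each rectangle.\<close>

lemma indep_vars_coord_increments:
  assumes \<tau>: "\<And>i. i \<le> n \<Longrightarrow> \<tau> i \<in> {0..1}" "mono_on {..n} \<tau>"
  shows "indep_vars (\<lambda>_. borel) (\<lambda>(i, c) \<omega>. coord c (W (\<tau> (Suc i)) \<omega> - W (\<tau> i) \<omega>))
    ({..<n::nat} \<times> UNIV)"
proof (cases "n = 0")
  case True
  thus ?thesis by (simp add: indep_vars_def indep_sets_def)
next
  case False
  define D where "D i \<omega> = W (\<tau> (Suc i)) \<omega> - W (\<tau> i) \<omega>" for i \<omega>
  have indep: "indep_vars (\<lambda>_. borel) D {..<n}"
    using independent_increments[OF \<tau>] by (simp add: D_def[abs_def])
  have D_meas [measurable]: "D i \<in> borel_measurable M" if "i < n" for i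
    using that \<tau>(1)[of i] \<tau>(1)[of "Suc i"] unfolding D_def
    by (intro borel_measurable_diff measurable_W) auto
  have "indep_vars (\<lambda>_. borel) (\<lambda>ic \<omega>. coord (snd ic) (D (fst ic) \<omega>)) ({..<n} \<times> UNIV)"
  proof (subst indep_vars_finite[where E="\<lambda>_. sets borel"])
    show "\<forall>A\<in>{..<n} \<times> UNIV \<rightarrow> sets borel.
      prob (\<Inter>j\<in>{..<n} \<times> UNIV. (\<lambda>\<omega>. coord (snd j) (D (fst j) \<omega>)) -` A j \<inter> space M)
      = (\<Prod>j\<in>{..<n} \<times> UNIV. prob ((\<lambda>\<omega>. coord (snd j) (D (fst j) \<omega>)) -` A j \<inter> space M))"
    proof
      fix A :: "nat \<times> bool \<Rightarrow> real set" assume A: "A \<in> {..<n} \<times> UNIV \<rightarrow> sets borel"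
      have "(\<Inter>j\<in>{..<n} \<times> UNIV. (\<lambda>\<omega>. coord (snd j) (D (fst j) \<omega>)) -` A j \<inter> space M)
          = (\<Inter>i\<in>{..<n}. D i -` (A (i, True) \<times> A (i, False)) \<inter> space M)"
        using False by (auto simp: coord_def UNIV_bool mem_Times_iff)
      also have "prob \<dots> = (\<Prod>i<n. prob (D i -` (A (i, True) \<times> A (i, False)) \<inter> space M))"
        using A False by (intro indep_varsD_finite[OF indep]) (auto simp: borel_prod[symmetric])
      also have "\<dots> = (\<Prod>i<n. \<Prod>c\<in>UNIV. prob ((\<lambda>\<omega>. coord c (D i \<omega>)) -` A (i, c) \<inter> space M))"
      proof (rule prod.cong)
        fix i assume "i \<in> {..<n}"
        hence i: "i \<le> n" "Suc i \<le> n" by auto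
        have "\<tau> i \<le> \<tau> (Suc i)" using i by (intro mono_onD[OF \<tau>(2)]) auto
        thus "prob (D i -` (A (i, True) \<times> A (i, False)) \<inter> space M)
            = (\<Prod>c\<in>UNIV. prob ((\<lambda>\<omega>. coord c (D i \<omega>)) -` A (i, c) \<inter> space M))"
          using prob_increment_Times[of "\<tau> i" "\<tau> (Suc i)" "A (i, True)" "A (i, False)"] A i \<tau>(1)[OF i(1)] \<tau>(1)[OF i(2)]
          by (auto simp: UNIV_bool coord_def D_def[abs_def] Pi_iff)
      qed simp
      finally show "prob (\<Inter>j\<in>{..<n} \<times> UNIV. (\<lambda>\<omega>. coord (snd j) (D (fst j) \<omega>)) -` A j \<inter> space M)
        = (\<Prod>j\<in>{..<n} \<times> UNIV. prob ((\<lambda>\<omega>. coord (snd j) (D (fst j) \<omega>)) -` A j \<inter> space M))"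
        by (simp add: prod.cartesian_product split_beta)
    qed
  next
    show "sets borel = sigma_sets (space borel) (sets borel)" for j :: "nat \<times> bool"
      by (metis sets.sigma_sets_eq)
  qed (use False in \<open>auto simp: Int_stable_def lessThan_empty_iff\<close>)
  thus ?thesis by (simp add: D_def split_beta')
qed

text \<open>Subtracting the starting point makes the initial condition hold on all of the sample space.\<close>

definition displ :: "bool \<Rightarrow> real \<Rightarrow> 'w \<Rightarrow> real" where
  "displ c t \<omega> = coord c (W t \<omega> - W 0 \<omega>)"

lemma measurable_displ: "t \<in> {0..1} \<Longrightarrow> displ c t \<in> borel_measurable M"
  unfolding displ_def by (intro measurable_compose[OF _ measurable_coord] borel_measurable_diff measurable_W) auto

text \<open>Both coordinates at finitely many times are sums of increments over a common sorted grid.\<close>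

lemma indep_var_displ:
  assumes "s \<in> {0..1}" "u \<in> {0..1}" "t \<in> {0..1}" "v \<in> {0..1}"
  shows "indep_var borel (\<lambda>\<omega>. (displ True s \<omega>, displ True u \<omega>))
    borel (\<lambda>\<omega>. (displ False t \<omega>, displ False v \<omega>))"
proof -
  \<comment> \<open>The leading 0 is the time from which \<open>displ\<close> is measured, so that
    each \<open>displ c r\<close> telescopes over the first increments. The five entries give four,
    possibly vanishing, increments.\<close>
  define L where "L = 0 # sort [s, u, t, v]"
  define \<tau> where "\<tau> i = L ! i" for i
  have len: "length L = 5" by (simp add: L_def)
  have set_L: "set L = {0, s, u, t, v}" by (auto simp: L_def)
  have sorted: "sorted L" using assms by (simp add: L_def del: sort_key_simps)
  have \<tau>_in: "\<tau> i \<in> {0..1}" if "i \<le> 4" for i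
  proof -
    have "\<tau> i \<in> set L" unfolding \<tau>_def using that len by (intro nth_mem) simp
    thus ?thesis using set_L assms by auto
  qed
  have mono: "mono_on {..4} \<tau>"
    using sorted len by (auto simp: \<tau>_def sorted_iff_nth_mono intro!: mono_onI)
  define X where "X = (\<lambda>(i, c) \<omega>. coord c (W (\<tau> (Suc i)) \<omega> - W (\<tau> i) \<omega>))"
  have indep: "indep_vars (\<lambda>_. borel) X ({..<4} \<times> UNIV)"
    unfolding X_def by (rule indep_vars_coord_increments[OF \<tau>_in mono])
  have "\<exists>j. j \<le> 4 \<and> \<tau> j = r" if "r \<in> set L" for r
  proof -
    obtain i where "i < length L" "L ! i = r" using \<open>r \<in> set L\<close> by (auto simp: in_set_conv_nth)
    thus ?thesis using len by (intro exI[of _ i]) (simp add: \<tau>_def)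
  qed
  then obtain J where J: "\<And>r. r \<in> set L \<Longrightarrow> J r \<le> (4::nat) \<and> \<tau> (J r) = r"
    by metis
  have displ_eq: "displ c r \<omega> = (\<Sum>i<J r. X (i, c) \<omega>)" if "r \<in> set L" for r c \<omega>
  proof -
    have "(\<Sum>i<J r. X (i, c) \<omega>) = coord c (W (\<tau> (J r)) \<omega> - W (\<tau> 0) \<omega>)"
      unfolding X_def using sum_lessThan_telescope[of "\<lambda>i. W (\<tau> i) \<omega>" "J r"] by (simp add: coord_sum[symmetric])
    thus ?thesis using J[OF that] by (simp add: displ_def \<tau>_def L_def)
  qed
  \<comment> \<open>The first coordinate uses only the increments labelled \<open>True\<close>, the
    second only those labelled \<open>False\<close>. These are disjoint blocks of an independent
    family.\<close>
  let ?A = "\<lambda>c::bool. {..<4::nat} \<times> {c}"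
  let ?F = "\<lambda>c r f. \<Sum>i<J r. f (i, c) :: real"
  have F: "?F c r \<in> borel_measurable (PiM (?A c) (\<lambda>_. borel))" if "r \<in> set L" for r c
    using J[OF that] by (intro borel_measurable_sum measurable_component_singleton) auto
  have "indep_var (PiM (?A True) (\<lambda>_. borel)) (\<lambda>\<omega>. restrict (\<lambda>i. X i \<omega>) (?A True))
      (PiM (?A False) (\<lambda>_. borel)) (\<lambda>\<omega>. restrict (\<lambda>i. X i \<omega>) (?A False))"
    by (rule indep_var_restrict[OF indep]) auto
  hence "indep_var borel ((\<lambda>f. (?F True s f, ?F True u f)) \<circ> (\<lambda>\<omega>. restrict (\<lambda>i. X i \<omega>) (?A True)))
      borel ((\<lambda>f. (?F False t f, ?F False v f)) \<circ> (\<lambda>\<omega>. restrict (\<lambda>i. X i \<omega>) (?A False)))"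
    unfolding borel_prod[symmetric]
    by (rule indep_var_compose) (auto intro!: measurable_Pair F simp: set_L)
  moreover have "?F c r (restrict (\<lambda>i. X i \<omega>) (?A c)) = displ c r \<omega>" if "r \<in> set L" for c r \<omega>
    unfolding displ_eq[OF that] using J[OF that] by (intro sum.cong) auto
  ultimately show ?thesis by (simp add: comp_def set_L)
qed

lemma distr_coord_increment_std:
  assumes "0 \<le> s" "s < t" "t \<le> 1"
  shows "distr M borel (\<lambda>\<omega>. coord c (W t \<omega> - W s \<omega>) / sqrt (t - s)) = std_normal"
proof -
  have [measurable]: "W t \<in> borel_measurable M" "W s \<in> borel_measurable M"
    using assms by (auto intro: measurable_W)
  have "distributed M lborel (\<lambda>\<omega>. coord c (W t \<omega> - W s \<omega>)) (normal_density 0 (sqrt (t - s)))"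
    using distr_coord_increment[OF assms, of c] unfolding distributed_def
    by (auto simp: distr_cong[of M M lborel borel])
  hence "distributed M lborel (\<lambda>\<omega>. (coord c (W t \<omega> - W s \<omega>) - 0) / sqrt (t - s)) std_normal_density"
    using assms by (subst normal_standard_normal_convert[symmetric]) auto
  hence "distr M lborel (\<lambda>\<omega>. coord c (W t \<omega> - W s \<omega>) / sqrt (t - s)) = std_normal"
    unfolding std_normal_def by (auto dest: distributed_distr_eq_density)
  thus ?thesis by (simp cong: distr_cong)
qed

lemma distr_displ:
  assumes "0 < t" "t \<le> 1"
  shows "distr M borel (\<lambda>\<omega>. displ c t \<omega> / sqrt t) = std_normal"
  using distr_coord_increment_std[of 0 t c] assms by (simp add: displ_def)

lemma AE_displ_neq_0:
  assumes "0 < t" "t \<le> 1"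
  shows "AE \<omega> in M. displ c t \<omega> \<noteq> 0"
proof -
  have [measurable]: "displ c t \<in> borel_measurable M"
    using assms by (intro measurable_displ) auto
  have "AE x in distr M borel (\<lambda>\<omega>. displ c t \<omega> / sqrt t). x \<noteq> 0"
    unfolding distr_displ[OF assms] by (rule AE_std_normal_neq_0)
  thus ?thesis by (subst (asm) AE_distr_iff) auto
qed

lemma expectation_sgn_displ:
  assumes "t \<in> {0..1}"
  shows "expectation (\<lambda>\<omega>. sgn (displ c t \<omega>)) = 0"
proof (cases "t = 0")
  case True
  thus ?thesis by (simp add: displ_def coord_def)
next
  case False
  hence t: "0 < t" "t \<le> 1" using assms by auto
  have [measurable]: "displ c t \<in> borel_measurable M"
    using assms by (intro measurable_displ) auto
  have "expectation (\<lambda>\<omega>. sgn (displ c t \<omega>)) = expectation (\<lambda>\<omega>. sgn (displ c t \<omega> / sqrt t))"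
    using t by simp
  also have "\<dots> = (\<integral>x. sgn x \<partial>distr M borel (\<lambda>\<omega>. displ c t \<omega> / sqrt t))"
    by (subst integral_distr) auto
  also have "\<dots> = 0" unfolding distr_displ[OF t] by (rule integral_sgn_std_normal)
  finally show ?thesis .
qed

text \<open>With U and V the normalised increments over [0,s] and [s,t], the later value is sqrt s U
  + sqrt (t - s) V. Dividing by sqrt t keeps its sign and turns the weights into those of
  \<open>sign_corr (s / t)\<close>.\<close>

lemma expectation_sgn_displ_mult:
  assumes "0 < s" "s < t" "t \<le> 1"
  shows "expectation (\<lambda>\<omega>. sgn (displ c s \<omega>) * sgn (displ c t \<omega>)) = sign_corr (s / t)"
proof -
  define \<tau> :: "nat \<Rightarrow> real" where "\<tau> i = (if i = 0 then 0 else if i = 1 then s else t)" for i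
  define U V where "U \<omega> = coord c (W s \<omega> - W 0 \<omega>) / sqrt s"
    and "V \<omega> = coord c (W t \<omega> - W s \<omega>) / sqrt (t - s)" for \<omega>
  have "indep_vars (\<lambda>_. borel) (\<lambda>(i, c) \<omega>. coord c (W (\<tau> (Suc i)) \<omega> - W (\<tau> i) \<omega>)) ({..<2} \<times> UNIV)"
    using assms by (intro indep_vars_coord_increments) (auto simp: \<tau>_def intro!: mono_onI)
  from indep_var_compose[OF indep_var_restrict[OF this, of "{(0, c)}" "{(1, c)}"],
      of "\<lambda>f. f (0, c)" borel "\<lambda>f. f (1, c)" borel]
  have "indep_var borel (\<lambda>\<omega>. coord c (W s \<omega> - W 0 \<omega>)) borel (\<lambda>\<omega>. coord c (W t \<omega> - W s \<omega>))"
    by (simp add: \<tau>_def comp_def)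
  from indep_var_compose[OF this, of "\<lambda>x. x / sqrt s" borel "\<lambda>x. x / sqrt (t - s)" borel]
  have indep: "indep_var borel U borel V"
    by (simp add: comp_def U_def[abs_def] V_def[abs_def])
  have [measurable]: "U \<in> borel_measurable M" "V \<in> borel_measurable M"
    using indep by (auto dest: indep_var_rv1 indep_var_rv2)
  have distr: "distr M (borel \<Otimes>\<^sub>M borel) (\<lambda>\<omega>. (U \<omega>, V \<omega>)) = std_normal \<Otimes>\<^sub>M std_normal"
    using indep distr_coord_increment_std[of 0 s c] distr_coord_increment_std[of s t c] assms
    by (simp add: indep_var_distribution_eq U_def[abs_def] V_def[abs_def])
  have "sgn (displ c s \<omega>) * sgn (displ c t \<omega>)
      = sgn (U \<omega>) * sgn (sqrt (s / t) * U \<omega> + sqrt (1 - s / t) * V \<omega>)" for \<omega>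
  proof -
    have "displ c s \<omega> = sqrt s * U \<omega>"
      using assms by (simp add: displ_def U_def)
    moreover have "displ c t \<omega> = sqrt s * U \<omega> + sqrt (t - s) * V \<omega>"
      using assms by (simp add: displ_def U_def V_def coord_diff)
    moreover have "1 - s / t = (t - s) / t" using assms by (simp add: field_simps)
    hence "sqrt (s / t) * U \<omega> + sqrt (1 - s / t) * V \<omega> = (sqrt s * U \<omega> + sqrt (t - s) * V \<omega>) / sqrt t"
      by (simp add: real_sqrt_divide add_divide_distrib)
    ultimately show ?thesis using assms by (simp add: sgn_mult)
  qed
  hence "expectation (\<lambda>\<omega>. sgn (displ c s \<omega>) * sgn (displ c t \<omega>))
      = (\<integral>x. sgn (fst x) * sgn (sqrt (s / t) * fst x + sqrt (1 - s / t) * snd x)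
          \<partial>distr M (borel \<Otimes>\<^sub>M borel) (\<lambda>\<omega>. (U \<omega>, V \<omega>)))"
    by (subst integral_distr) auto
  thus ?thesis unfolding distr sign_corr_def .
qed

end

section \<open>The averaged sign correlation as a function of time\<close>

lemma space_unit_lborel: "space unit_lborel = {0..1}"
  by (simp add: space_restrict_space)

interpretation unit_lborel: prob_space unit_lborel
  by (rule prob_spaceI) (simp add: emeasure_restrict_space space_restrict_space)

lemma measurable_unit_lborel_ident: "(\<lambda>x. x) \<in> borel_measurable unit_lborel"
  by (intro measurable_restrict_space1) simp

lemma AE_unit_lborelD:
  assumes "AE x in unit_lborel. P x"
  shows "AE x in lborel. x \<in> {0..1} \<longrightarrow> P x"
  using assms by (subst (asm) AE_restrict_space_iff) auto

lemma AE_unit_lborel_neq: "AE x in unit_lborel. x \<noteq> c"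
  using AE_lborel_singleton[of c] by (subst AE_restrict_space_iff) auto

lemma AE_unit_lborel_pos: "AE x in unit_lborel. 0 < x \<and> x \<le> 1"
  using AE_space[of unit_lborel] AE_unit_lborel_neq[of 0]
  by eventually_elim (auto simp: space_unit_lborel)

text \<open>Agrees with E[a_s a_t] for distinct times in (0,1]; \<open>min\<close> and
  \<open>max\<close> cover both orders. If one time is 0 and the other is nonnegative, the value is
  \<open>sign_corr 0\<close>, also for 0 / 0.\<close>

definition corr :: "real \<Rightarrow> real \<Rightarrow> real" where
  "corr s t = sign_corr (min s t / max s t)"

text \<open>The function m of the overview, with the expectation already evaluated;
  \<open>expectation_sign_mult_mean_sign\<close> makes the link.\<close>

definition mean_corr :: "real \<Rightarrow> real" where
  "mean_corr t = (\<integral>s. corr s t \<partial>unit_lborel)"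

lemma corr_commute: "corr s t = corr t s"
  by (simp add: corr_def min.commute max.commute)

lemma corr_bounded: "\<bar>corr s t\<bar> \<le> 1"
  by (simp add: corr_def sign_corr_bounded)

lemma measurable_corr [measurable]: "(\<lambda>(s, t). corr s t) \<in> borel_measurable (borel \<Otimes>\<^sub>M borel)"
  unfolding corr_def by measurable

lemma measurable_corr_unit:
  "(\<lambda>(s, t). corr s t) \<in> borel_measurable (unit_lborel \<Otimes>\<^sub>M unit_lborel)"
proof -
  have "(\<lambda>p. (fst p, snd p)) \<in> unit_lborel \<Otimes>\<^sub>M unit_lborel \<rightarrow>\<^sub>M borel \<Otimes>\<^sub>M (borel :: real measure)"
    by (intro measurable_Pair measurable_compose[OF measurable_fst measurable_unit_lborel_ident]
        measurable_compose[OF measurable_snd measurable_unit_lborel_ident])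
  from measurable_compose[OF this measurable_corr] show ?thesis by (simp add: split_beta')
qed

lemma measurable_corr_fst: "(\<lambda>s. corr s t) \<in> borel_measurable unit_lborel"
  by (intro measurable_restrict_space1) (simp add: corr_def)

lemma measurable_mean_corr: "mean_corr \<in> borel_measurable unit_lborel"
  unfolding mean_corr_def
  using measurable_corr_unit
  by (intro unit_lborel.borel_measurable_lebesgue_integral) (simp add: corr_commute)

lemma mean_corr_bounded: "\<bar>mean_corr t\<bar> \<le> 1"
proof -
  have "norm (mean_corr t) \<le> (\<integral>s. 1 \<partial>unit_lborel)"
    unfolding mean_corr_def
    by (rule Bochner_Integration.integral_norm_bound_integral)
       (auto intro!: unit_lborel.integrable_bounded_real[where c=1] measurable_corr_fst corr_bounded)
  thus ?thesis using unit_lborel.prob_space by simp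
qed

text \<open>Substitute s = t v: the Jacobian contributes t, and the remaining integral is 1/2. Since
  t is at most 1, the range [0,t] stays in the unit interval.\<close>

lemma integral_sign_corr_scaled:
  assumes "0 < t" "t \<le> 1"
  shows "(\<integral>s. indicator {0..t} s * sign_corr (s / t) \<partial>unit_lborel) = t / 2"
proof -
  have "(\<integral>s. indicator {0..t} s * sign_corr (s / t) \<partial>unit_lborel)
      = (\<integral>s. indicator {0..1} s *\<^sub>R (indicator {0..t} s * sign_corr (s / t)) \<partial>lborel)"
    by (subst integral_restrict_space) auto
  also have "\<dots> = \<bar>t\<bar> *\<^sub>R (\<integral>x. indicator {0..1} (0 + t * x) *\<^sub>R
      (indicator {0..t} (0 + t * x) * sign_corr ((0 + t * x) / t)) \<partial>lborel)"
    using assms by (intro lborel_integral_real_affine) auto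
  also have "(\<integral>x. indicator {0..1} (0 + t * x) *\<^sub>R
      (indicator {0..t} (0 + t * x) * sign_corr ((0 + t * x) / t)) \<partial>lborel)
      = (\<integral>x. indicator {0..1} x *\<^sub>R sign_corr x \<partial>lborel)"
  proof (rule Bochner_Integration.integral_cong)
    fix x :: real
    have "t * x \<le> 1" if "x \<le> 1" "0 \<le> x"
      using that assms mult_mono[of t 1 x 1] by simp
    moreover have "0 \<le> t * x \<longleftrightarrow> 0 \<le> x" "t * x \<le> t \<longleftrightarrow> x \<le> 1"
      using assms by (auto simp: zero_le_mult_iff)
    ultimately show "indicator {0..1} (0 + t * x) *\<^sub>R
        (indicator {0..t} (0 + t * x) * sign_corr ((0 + t * x) / t)) = indicator {0..1} x *\<^sub>R sign_corr x"
      using assms by (auto simp: indicator_def)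
  qed simp
  also have "\<dots> = (\<integral>v. sign_corr v \<partial>unit_lborel)"
    by (subst integral_restrict_space) auto
  finally show ?thesis using assms by (simp add: integral_sign_corr)
qed

lemma mean_corr_1: "mean_corr 1 = 1 / 2"
proof -
  have "mean_corr 1 = (\<integral>s. sign_corr s \<partial>unit_lborel)"
    unfolding mean_corr_def
    by (rule Bochner_Integration.integral_cong) (auto simp: space_unit_lborel corr_def)
  thus ?thesis by (simp add: integral_sign_corr)
qed

text \<open>Cut the unit square along the diagonal. The triangle s \<le> t contributes the integral
  of t/2, which is 1/4, and the other triangle contributes the same by symmetry and Fubini.\<close>

lemma integral_mean_corr: "(\<integral>t. mean_corr t \<partial>unit_lborel) = 1 / 2"
proof -
  interpret UU: pair_prob_space unit_lborel unit_lborel ..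
  define low where "low s t = indicator {0..t} s * corr s t" for s t :: real
  have ident: "fst \<in> borel_measurable (unit_lborel \<Otimes>\<^sub>M unit_lborel)"
    "snd \<in> borel_measurable (unit_lborel \<Otimes>\<^sub>M unit_lborel)"
    using measurable_compose[OF measurable_fst measurable_unit_lborel_ident]
      measurable_compose[OF measurable_snd measurable_unit_lborel_ident] by auto
  have low_m: "(\<lambda>(s, t). low s t) \<in> borel_measurable (unit_lborel \<Otimes>\<^sub>M unit_lborel)"
  proof -
    have "(\<lambda>p. (if 0 \<le> fst p \<and> fst p \<le> snd p then 1 else 0) * (case p of (s, t) \<Rightarrow> corr s t))
        \<in> borel_measurable (unit_lborel \<Otimes>\<^sub>M unit_lborel)"
      using ident measurable_corr_unit by measurable
    thus ?thesis
      by (rule back_subst[where P="\<lambda>f. f \<in> borel_measurable _"]) (auto simp: low_def indicator_def)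
  qed
  have low_b: "\<bar>low s t\<bar> \<le> 1" for s t
    using corr_bounded[of s t] by (auto simp: low_def indicator_def)
  have low_i: "integrable (unit_lborel \<Otimes>\<^sub>M unit_lborel) (\<lambda>(s, t). low s t)"
    using low_m low_b by (intro UU.integrable_bounded_real[where c=1]) auto
  have low_fst: "(\<lambda>s. low s t) \<in> borel_measurable unit_lborel"
    and low_snd: "(\<lambda>s. low t s) \<in> borel_measurable unit_lborel" if "t \<in> {0..1}" for t
    using measurable_compose[OF measurable_Pair2'[of t unit_lborel unit_lborel] low_m]
      measurable_compose[OF measurable_Pair1'[of t unit_lborel unit_lborel] low_m] that
    by (simp_all add: space_unit_lborel)
  have mean: "mean_corr t = (\<integral>s. low s t \<partial>unit_lborel) + (\<integral>s. low t s \<partial>unit_lborel)"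
    if t: "t \<in> {0..1}" for t
  proof -
    have "mean_corr t = (\<integral>s. low s t + low t s \<partial>unit_lborel)"
      unfolding mean_corr_def
    proof (rule integral_cong_AE)
      \<comment> \<open>At s = t both terms on the right contribute, so the identity is claimed only
        off this null set.\<close>
      show "AE s in unit_lborel. corr s t = low s t + low t s"
        using AE_unit_lborel_neq[of t] AE_space
      proof eventually_elim
        case (elim s)
        thus ?case using t
          by (cases s t rule: linorder_cases) (auto simp: low_def space_unit_lborel corr_commute)
      qed
    qed (intro measurable_corr_fst borel_measurable_add low_fst[OF t] low_snd[OF t])+
    also have "\<dots> = (\<integral>s. low s t \<partial>unit_lborel) + (\<integral>s. low t s \<partial>unit_lborel)"
      using low_fst[OF t] low_snd[OF t] low_b
      by (intro Bochner_Integration.integral_add unit_lborel.integrable_bounded_real[where c=1]) auto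
    finally show ?thesis .
  qed
  have low_int: "(\<integral>s. low s t \<partial>unit_lborel) = t / 2" if t: "t \<in> {0..1}" for t
  proof (cases "t = 0")
    case True
    have "(\<integral>s. low s t \<partial>unit_lborel) = (\<integral>s. 0 \<partial>unit_lborel)"
      using AE_unit_lborel_neq[of 0] low_fst[OF t]
      by (intro integral_cong_AE) (auto simp: low_def True)
    thus ?thesis using True by simp
  next
    case False
    hence "(\<integral>s. low s t \<partial>unit_lborel) = (\<integral>s. indicator {0..t} s * sign_corr (s / t) \<partial>unit_lborel)"
      by (intro Bochner_Integration.integral_cong) (auto simp: low_def corr_def indicator_def min_def max_def)
    thus ?thesis using integral_sign_corr_scaled[of t] t False by auto
  qed
  have fub: "(\<integral>t. \<integral>s. low s t \<partial>unit_lborel \<partial>unit_lborel) = (\<integral>t. \<integral>s. low t s \<partial>unit_lborel \<partial>unit_lborel)"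
    using UU.Fubini_integral[OF low_i] .
  have "(\<integral>t. mean_corr t \<partial>unit_lborel)
      = (\<integral>t. (\<integral>s. low s t \<partial>unit_lborel) + (\<integral>s. low t s \<partial>unit_lborel) \<partial>unit_lborel)"
    by (rule Bochner_Integration.integral_cong) (auto simp: mean space_unit_lborel)
  also have "\<dots> = (\<integral>t. \<integral>s. low s t \<partial>unit_lborel \<partial>unit_lborel) + (\<integral>t. \<integral>s. low t s \<partial>unit_lborel \<partial>unit_lborel)"
    using UU.integrable_fst'[OF low_i] UU.integrable_snd[OF low_i]
    by (intro Bochner_Integration.integral_add) auto
  also have "\<dots> = 2 * (\<integral>t. \<integral>s. low s t \<partial>unit_lborel \<partial>unit_lborel)"
    by (simp add: fub)
  also have "(\<integral>t. \<integral>s. low s t \<partial>unit_lborel \<partial>unit_lborel) = (\<integral>t. t / 2 \<partial>unit_lborel)"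
    by (rule Bochner_Integration.integral_cong) (auto simp: low_int space_unit_lborel)
  \<comment> \<open>The exponent 1 is written out to match \<open>integral_power\<close>.\<close>
  also have "\<dots> = (\<integral>t. t ^ 1 * indicator {0..1} t \<partial>lborel) / 2"
    by (subst integral_restrict_space) (auto simp: mult.commute)
  also have "\<dots> = 1 / 4"
    by (subst integral_power) auto
  finally show ?thesis by simp
qed

text \<open>For fixed s > 0 the time \<open>t n\<close> is eventually below s. The integrand is then
  \<open>sign_corr (t n / s)\<close>, which tends to 0, and dominated convergence applies.\<close>

lemma mean_corr_tendsto_0:
  assumes "t \<longlonglongrightarrow> 0" "\<And>n. 0 < t n"
  shows "(\<lambda>n. mean_corr (t n)) \<longlonglongrightarrow> 0"
proof -
  have "(\<lambda>n. mean_corr (t n)) \<longlonglongrightarrow> (\<integral>s. 0 \<partial>unit_lborel)"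
    unfolding mean_corr_def
  proof (rule integral_dominated_convergence[where w="\<lambda>_. 1"])
    show "AE s in unit_lborel. (\<lambda>n. corr s (t n)) \<longlonglongrightarrow> 0"
      using AE_unit_lborel_pos
    proof eventually_elim
      case (elim s)
      have "(\<lambda>n. t n / s) \<longlonglongrightarrow> 0 / s"
        using elim by (intro tendsto_divide assms) auto
      hence "(\<lambda>n. sign_corr (t n / s)) \<longlonglongrightarrow> 0"
        by (intro sign_corr_tendsto_0) simp
      moreover have "eventually (\<lambda>n. t n < s) sequentially"
        using assms(1) elim by (auto dest: order_tendstoD)
      hence "eventually (\<lambda>n. sign_corr (t n / s) = corr s (t n)) sequentially"
        by eventually_elim (simp add: corr_def min_def max_def)
      ultimately show ?case by (rule Lim_transform_eventually)
    qed
  qed (auto intro: measurable_corr_fst corr_bounded)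
  thus ?thesis by simp
qed

text \<open>Otherwise the interval (0, min d 1), which has positive length, would be a null set.
  This extracts from an almost everywhere statement a sequence of times tending to 0.\<close>

lemma AE_unit_lborel_exists_small:
  assumes "AE x in unit_lborel. P x" "0 < d"
  shows "\<exists>x. 0 < x \<and> x < d \<and> P x"
proof (rule ccontr)
  assume none: "\<nexists>x. 0 < x \<and> x < d \<and> P x"
  have "AE x in lborel. x \<notin> {0<..<min d 1}"
    using AE_unit_lborelD[OF assms(1)] by eventually_elim (use none in auto)
  hence "{0<..<min d 1} \<in> null_sets lborel"
    by (subst AE_iff_null_sets) auto
  thus False using assms(2) by (auto simp: null_sets_def)
qed

lemma mean_corr_not_AE_half: "\<not> (AE t in unit_lborel. mean_corr t = 1 / 2)"
proof
  assume "AE t in unit_lborel. mean_corr t = 1 / 2"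
  hence "\<exists>t. 0 < t \<and> t < inverse (real (Suc n)) \<and> mean_corr t = 1 / 2" for n
    by (rule AE_unit_lborel_exists_small) simp
  then obtain t where t: "\<And>n. 0 < t n" "\<And>n. t n < inverse (real (Suc n))" "\<And>n. mean_corr (t n) = 1 / 2"
    by metis
  have "t \<longlonglongrightarrow> 0"
    by (rule tendsto_sandwich[OF _ _ tendsto_const LIMSEQ_inverse_real_of_nat])
       (auto intro!: always_eventually less_imp_le t simp del: of_nat_Suc)
  from mean_corr_tendsto_0[OF this t(1)] have "(\<lambda>n. 1 / 2 :: real) \<longlonglongrightarrow> 0"
    by (simp add: t(3))
  thus False by (simp add: LIMSEQ_const_iff)
qed

text \<open>Equality would make the variance of \<open>mean_corr\<close> under the uniform law 1/4 -
  1/2 + 1/4 = 0, so \<open>mean_corr\<close> would be 1/2 almost everywhere.\<close>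

lemma integral_mean_corr_square_neq: "(\<integral>t. (mean_corr t)\<^sup>2 \<partial>unit_lborel) \<noteq> (mean_corr 1)\<^sup>2"
proof
  assume eq: "(\<integral>t. (mean_corr t)\<^sup>2 \<partial>unit_lborel) = (mean_corr 1)\<^sup>2"
  note [measurable] = measurable_mean_corr
  have i1: "integrable unit_lborel mean_corr"
    by (rule unit_lborel.integrable_bounded_real[where c=1]) (auto simp: mean_corr_bounded)
  have i2: "integrable unit_lborel (\<lambda>t. (mean_corr t)\<^sup>2)"
    by (rule unit_lborel.integrable_bounded_real[where c=1])
       (auto simp: mean_corr_bounded abs_square_le_1)
  have expand: "(mean_corr t - 1 / 2)\<^sup>2 = (mean_corr t)\<^sup>2 - mean_corr t + 1 / 4" for t
    by (simp add: power2_eq_square algebra_simps)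
  have "(\<integral>t. (mean_corr t - 1 / 2)\<^sup>2 \<partial>unit_lborel)
      = (\<integral>t. (mean_corr t)\<^sup>2 \<partial>unit_lborel) - (\<integral>t. mean_corr t \<partial>unit_lborel) + 1 / 4"
    using i1 i2 unit_lborel.prob_space unfolding expand by simp
  also have "\<dots> = 0"
    unfolding eq mean_corr_1 integral_mean_corr by (simp add: power2_eq_square)
  finally have "AE t in unit_lborel. (mean_corr t - 1 / 2)\<^sup>2 = 0"
  proof (subst (asm) integral_nonneg_eq_0_iff_AE)
    show "integrable unit_lborel (\<lambda>t. (mean_corr t - 1 / 2)\<^sup>2)"
      unfolding expand using i1 i2 by simp
  qed auto
  hence "AE t in unit_lborel. mean_corr t = 1 / 2"
    by eventually_elim simp
  thus False using mean_corr_not_AE_half by simp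
qed

section \<open>Quadrants in terms of coordinate signs\<close>

definition x_sign :: "nat \<Rightarrow> real" where
  "x_sign k = (if k \<in> {1, 2} then 1 else - 1)"

definition y_sign :: "nat \<Rightarrow> real" where
  "y_sign k = (if k \<in> {1, 4} then 1 else - 1)"

lemma atLeastAtMost_1_4: "{1..4::nat} = {1, 2, 3, 4}"
  by auto

text \<open>Off the axes, each factor on the right is twice the indicator of a half-plane, and the
  quadrant is the intersection of two half-planes.\<close>

lemma indicator_quadrant:
  assumes "k \<in> {1..4}" "fst p \<noteq> 0" "snd p \<noteq> 0"
  shows "4 * indicat_real (quadrant k) p = (1 + x_sign k * sgn (fst p)) * (1 + y_sign k * sgn (snd p))"
  using assms unfolding atLeastAtMost_1_4
  by (cases p) (auto simp: quadrant_def x_sign_def y_sign_def indicator_def sgn_if)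

lemma sum_1_4: "(\<Sum>k\<in>{1..4::nat}. h k) = h 1 + h 2 + h 3 + (h 4 :: real)"
  by (simp add: atLeastAtMost_1_4 del: One_nat_def)

text \<open>Integrated over time, this makes A a linear combination of occupation times, hence an
  admissible ingredient of a test function for the conditional expectation.\<close>

lemma sgn_fst_eq_sum_quadrants:
  assumes "fst p \<noteq> 0" "snd p \<noteq> 0"
  shows "sgn (fst p) = (\<Sum>k\<in>{1..4}. x_sign k * indicat_real (quadrant k) p)"
  using assms unfolding sum_1_4
  by (cases p) (auto simp: quadrant_def x_sign_def indicator_def sgn_if)

lemma sgn_snd_eq_sum_quadrants:
  assumes "fst p \<noteq> 0" "snd p \<noteq> 0"
  shows "sgn (snd p) = (\<Sum>k\<in>{1..4}. y_sign k * indicat_real (quadrant k) p)"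
  using assms unfolding sum_1_4
  by (cases p) (auto simp: quadrant_def y_sign_def indicator_def sgn_if)

lemma quadrant_borel [measurable]: "quadrant k \<in> sets borel"
proof -
  have *: "{(x, y). P x \<and> Q y} = {x. P x} \<times> {y. Q y}" for P Q :: "real \<Rightarrow> bool"
    by auto
  show ?thesis
    unfolding quadrant_def * by (auto simp: borel_prod[symmetric])
qed

section \<open>Time-averaged signs and occupation times\<close>

context planar_brownian_motion
begin

interpretation time: pair_prob_space M unit_lborel ..

text \<open>By continuity of paths, the process is the pointwise limit of its evaluations at grid points,
  which depend on the time only through a countable index.\<close>

lemma measurable_W_joint: "(\<lambda>(\<omega>, t). W t \<omega>) \<in> borel_measurable (M \<Otimes>\<^sub>M unit_lborel)"
proof -
  \<comment> \<open>Capping at 1 keeps every grid point, for every index, in the interval on which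
    \<open>W\<close> is known to be measurable. Rounding down through \<open>idx\<close>
    approximates t from below with error at most 1 / (n + 1).\<close>
  define grid :: "nat \<Rightarrow> nat \<Rightarrow> real" where "grid n i = min 1 (real i / real (Suc n))" for n i
  define idx :: "nat \<Rightarrow> real \<Rightarrow> nat" where "idx n t = nat \<lfloor>t * real (Suc n)\<rfloor>" for n t
  have [measurable]: "snd \<in> M \<Otimes>\<^sub>M unit_lborel \<rightarrow>\<^sub>M borel"
    by (intro measurable_compose[OF measurable_snd measurable_unit_lborel_ident])
  have "(\<lambda>p. W (snd p) (fst p)) \<in> borel_measurable (M \<Otimes>\<^sub>M unit_lborel)"
  proof (rule borel_measurable_LIMSEQ_metric)
    fix n
    show "(\<lambda>p. W (grid n (idx n (snd p))) (fst p)) \<in> borel_measurable (M \<Otimes>\<^sub>M unit_lborel)"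
    proof (rule measurable_compose_countable)
      show "(\<lambda>p. W (grid n i) (fst p)) \<in> borel_measurable (M \<Otimes>\<^sub>M unit_lborel)" for i
        by (intro measurable_compose[OF measurable_fst] measurable_W) (auto simp: grid_def)
      show "(\<lambda>p. idx n (snd p)) \<in> M \<Otimes>\<^sub>M unit_lborel \<rightarrow>\<^sub>M count_space UNIV"
        unfolding idx_def by measurable
    qed
  next
    fix p assume p: "p \<in> space (M \<Otimes>\<^sub>M unit_lborel)"
    hence \<omega>: "fst p \<in> space M" and t: "snd p \<in> {0..1}"
      by (auto simp: space_pair_measure space_unit_lborel)
    have close: "snd p - inverse (real (Suc n)) \<le> grid n (idx n (snd p)) \<and> grid n (idx n (snd p)) \<le> snd p" for n
    proof -
      define N where "N = real (Suc n)"
      have N: "0 < N" by (simp add: N_def)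
      have idx: "real (idx n (snd p)) = of_int \<lfloor>snd p * N\<rfloor>"
        using t by (simp add: idx_def N_def)
      have "real (idx n (snd p)) \<le> snd p * N"
        unfolding idx by linarith
      hence upper: "real (idx n (snd p)) / N \<le> snd p"
        using N by (simp add: pos_divide_le_eq)
      have "snd p * N - 1 \<le> real (idx n (snd p))"
        unfolding idx by linarith
      hence "(snd p * N - 1) / N \<le> real (idx n (snd p)) / N"
        using N by (intro divide_right_mono) auto
      moreover have "(snd p * N - 1) / N = snd p - inverse N"
        using N by (simp add: diff_divide_distrib inverse_eq_divide)
      ultimately have lower: "snd p - inverse N \<le> real (idx n (snd p)) / N"
        by simp
      have "snd p - inverse N \<le> 1"
        using t N by (simp add: order_trans[of _ "snd p"])
      thus ?thesis
        using lower upper unfolding grid_def N_def[symmetric] by (simp add: min_le_iff_disj)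
    qed
    have lim: "(\<lambda>n. snd p - inverse (real (Suc n))) \<longlonglongrightarrow> snd p - 0"
      by (intro tendsto_diff tendsto_const LIMSEQ_inverse_real_of_nat)
    have "(\<lambda>n. grid n (idx n (snd p))) \<longlonglongrightarrow> snd p"
    proof (rule tendsto_sandwich)
      show "\<forall>\<^sub>F n in sequentially. snd p - inverse (real (Suc n)) \<le> grid n (idx n (snd p))"
        "\<forall>\<^sub>F n in sequentially. grid n (idx n (snd p)) \<le> snd p"
        using close by (intro always_eventually allI; blast)+
      show "(\<lambda>n. snd p - inverse (real (Suc n))) \<longlonglongrightarrow> snd p"
        using lim by (simp only: diff_zero)
    qed (rule tendsto_const)
    moreover have "grid n (idx n (snd p)) \<in> {0..1}" for n
      by (auto simp: grid_def)
    ultimately show "(\<lambda>n. W (grid n (idx n (snd p))) (fst p)) \<longlonglongrightarrow> W (snd p) (fst p)"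
      using t by (intro continuous_on_tendsto_compose[OF continuous_paths[OF \<omega>]]) auto
  qed
  thus ?thesis by (simp add: split_beta')
qed

definition sign :: "bool \<Rightarrow> real \<Rightarrow> 'w \<Rightarrow> real" where
  "sign c t \<omega> = sgn (displ c t \<omega>)"

text \<open>The variables A (\<open>True\<close>) and B (\<open>False\<close>) of the overview,
  built from displacements and thus free of exceptional null sets.\<close>

definition mean_sign :: "bool \<Rightarrow> 'w \<Rightarrow> real" where
  "mean_sign c \<omega> = (\<integral>t. sign c t \<omega> \<partial>unit_lborel)"

lemma sign_bounded: "\<bar>sign c t \<omega>\<bar> \<le> 1"
  by (simp add: sign_def abs_sgn_le_1)

lemma measurable_sign: "t \<in> {0..1} \<Longrightarrow> sign c t \<in> borel_measurable M"
  unfolding sign_def by (rule borel_measurable_sgn[THEN measurable_compose[rotated]]) (rule measurable_displ)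

lemma measurable_sign_joint: "(\<lambda>(\<omega>, t). sign c t \<omega>) \<in> borel_measurable (M \<Otimes>\<^sub>M unit_lborel)"
proof -
  have [measurable]: "W 0 \<in> borel_measurable M" by (intro measurable_W) simp
  note [measurable] = measurable_W_joint
  have "(\<lambda>p. sgn (coord c ((case p of (\<omega>, t) \<Rightarrow> W t \<omega>) - W 0 (fst p)))) \<in> borel_measurable (M \<Otimes>\<^sub>M unit_lborel)"
    by measurable
  thus ?thesis by (simp add: sign_def displ_def split_beta')
qed

lemma measurable_sign_path: "\<omega> \<in> space M \<Longrightarrow> (\<lambda>t. sign c t \<omega>) \<in> borel_measurable unit_lborel"
  using measurable_compose[OF measurable_Pair1' measurable_sign_joint] by simp

lemma measurable_mean_sign [measurable]: "mean_sign c \<in> borel_measurable M"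
  unfolding mean_sign_def
  using measurable_sign_joint by (intro unit_lborel.borel_measurable_lebesgue_integral) simp

lemma mean_sign_bounded: "\<omega> \<in> space M \<Longrightarrow> \<bar>mean_sign c \<omega>\<bar> \<le> 1"
proof -
  assume \<omega>: "\<omega> \<in> space M"
  have "norm (mean_sign c \<omega>) \<le> (\<integral>s. 1 \<partial>unit_lborel)"
    unfolding mean_sign_def
    by (rule Bochner_Integration.integral_norm_bound_integral)
       (auto intro!: unit_lborel.integrable_bounded_real[where c=1] measurable_sign_path sign_bounded \<omega>)
  thus ?thesis using unit_lborel.prob_space by simp
qed

text \<open>Fubini, with integrability from boundedness. It trades a path functional for a sign at
  one fixed time, where \<open>indep_var_displ\<close> can act.\<close>

lemma expectation_mult_mean_sign:
  assumes [measurable]: "h \<in> borel_measurable M" and bound: "\<And>\<omega>. \<omega> \<in> space M \<Longrightarrow> \<bar>h \<omega>\<bar> \<le> C"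
  shows "expectation (\<lambda>\<omega>. h \<omega> * mean_sign c \<omega>)
    = (\<integral>t. expectation (\<lambda>\<omega>. h \<omega> * sign c t \<omega>) \<partial>unit_lborel)"
proof -
  note [measurable] = measurable_sign_joint
  have "(\<lambda>p. h (fst p) * (case p of (\<omega>, t) \<Rightarrow> sign c t \<omega>)) \<in> borel_measurable (M \<Otimes>\<^sub>M unit_lborel)"
    by measurable
  hence "integrable (M \<Otimes>\<^sub>M unit_lborel) (\<lambda>(\<omega>, t). h \<omega> * sign c t \<omega>)"
  proof (intro time.integrable_bounded_real[where c=C])
    show "\<bar>case p of (\<omega>, t) \<Rightarrow> h \<omega> * sign c t \<omega>\<bar> \<le> C"
      if "p \<in> space (M \<Otimes>\<^sub>M unit_lborel)" for p
    proof (cases p)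
      case (Pair \<omega> t)
      hence "\<bar>h \<omega>\<bar> \<le> C" using that by (auto simp: space_pair_measure intro: bound)
      thus ?thesis
        using mult_mono[OF _ sign_bounded[of c t \<omega>], of "\<bar>h \<omega>\<bar>" C] Pair by (simp add: abs_mult)
    qed
  qed (simp add: split_beta')
  from time.Fubini_integral[OF this] show ?thesis
    by (simp add: mean_sign_def)
qed

text \<open>Opening both averages by Fubini leaves the first coordinate at times u, s and the second
  at times u, t. For these, \<open>indep_var_displ\<close> gives independence, and closing the
  averages again yields the two factors.\<close>

lemma expectation_split:
  assumes f: "f \<in> borel_measurable borel" "\<And>x. \<bar>f x\<bar> \<le> C"
    and g: "g \<in> borel_measurable borel" "\<And>x. \<bar>g x\<bar> \<le> C" and u: "u \<in> {0..1}"
  shows "expectation (\<lambda>\<omega>. (f (displ True u \<omega>) * mean_sign True \<omega>) * (g (displ False u \<omega>) * mean_sign False \<omega>))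
    = expectation (\<lambda>\<omega>. f (displ True u \<omega>) * mean_sign True \<omega>)
      * expectation (\<lambda>\<omega>. g (displ False u \<omega>) * mean_sign False \<omega>)"
proof -
  note [measurable] = f(1) g(1)
  have [measurable]: "displ c u \<in> borel_measurable M" for c
    using u by (rule measurable_displ)
  have C: "0 \<le> C" using f(2)[of 0] by linarith
  let ?f = "\<lambda>\<omega>. f (displ True u \<omega>)" and ?g = "\<lambda>\<omega>. g (displ False u \<omega>)"
  have indep: "expectation (\<lambda>\<omega>. (?f \<omega> * sign True s \<omega>) * (?g \<omega> * sign False t \<omega>))
      = expectation (\<lambda>\<omega>. ?f \<omega> * sign True s \<omega>) * expectation (\<lambda>\<omega>. ?g \<omega> * sign False t \<omega>)"
    if s: "s \<in> {0..1}" and t: "t \<in> {0..1}" for s t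
  proof -
    have pm: "(\<lambda>p. f (fst p) * sgn (snd p)) \<in> borel_measurable (borel :: (real \<times> real) measure)"
      "(\<lambda>p. g (fst p) * sgn (snd p)) \<in> borel_measurable (borel :: (real \<times> real) measure)"
      unfolding borel_prod[symmetric] by measurable
    have "indep_var borel (\<lambda>\<omega>. ?f \<omega> * sign True s \<omega>) borel (\<lambda>\<omega>. ?g \<omega> * sign False t \<omega>)"
      using indep_var_compose[OF indep_var_displ[OF u s u t] pm] by (simp add: comp_def sign_def)
    moreover have "integrable M (\<lambda>\<omega>. ?f \<omega> * sign True s \<omega>)" "integrable M (\<lambda>\<omega>. ?g \<omega> * sign False t \<omega>)"
      using measurable_sign[OF s] measurable_sign[OF t] f(2) g(2) C
      by (auto intro!: integrable_bounded_real[where c="C * 1"] mult_mono sign_bounded simp: abs_mult simp del: mult_1_right)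
    ultimately show ?thesis by (rule indep_var_lebesgue_integral)
  qed
  have swap_f: "expectation (\<lambda>\<omega>. ?f \<omega> * mean_sign True \<omega>)
      = (\<integral>s. expectation (\<lambda>\<omega>. ?f \<omega> * sign True s \<omega>) \<partial>unit_lborel)"
    by (rule expectation_mult_mean_sign[where C=C]) (auto simp: f)
  have swap_g: "expectation (\<lambda>\<omega>. ?g \<omega> * mean_sign False \<omega>)
      = (\<integral>t. expectation (\<lambda>\<omega>. ?g \<omega> * sign False t \<omega>) \<partial>unit_lborel)"
    by (rule expectation_mult_mean_sign[where C=C]) (auto simp: g)
  \<comment> \<open>The first average is already open, at the fixed time s; only the second one is
    opened here.\<close>
  have inner: "expectation (\<lambda>\<omega>. (?f \<omega> * sign True s \<omega>) * (?g \<omega> * mean_sign False \<omega>))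
      = expectation (\<lambda>\<omega>. ?f \<omega> * sign True s \<omega>) * expectation (\<lambda>\<omega>. ?g \<omega> * mean_sign False \<omega>)"
    if s: "s \<in> {0..1}" for s
  proof -
    note [measurable] = measurable_sign[OF s]
    have "expectation (\<lambda>\<omega>. (?f \<omega> * sign True s \<omega> * ?g \<omega>) * mean_sign False \<omega>)
        = (\<integral>t. expectation (\<lambda>\<omega>. (?f \<omega> * sign True s \<omega> * ?g \<omega>) * sign False t \<omega>) \<partial>unit_lborel)"
      by (rule expectation_mult_mean_sign[where C="C * 1 * C"])
         (auto simp: abs_mult f g C sign_bounded simp del: mult_1_right intro!: mult_mono)
    also have "\<dots> = (\<integral>t. expectation (\<lambda>\<omega>. ?f \<omega> * sign True s \<omega>) * expectation (\<lambda>\<omega>. ?g \<omega> * sign False t \<omega>) \<partial>unit_lborel)"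
      by (rule Bochner_Integration.integral_cong)
         (auto simp: space_unit_lborel indep[OF s, symmetric] mult.assoc)
    finally show ?thesis by (simp add: swap_g mult.assoc)
  qed
  have "expectation (\<lambda>\<omega>. (?f \<omega> * (?g \<omega> * mean_sign False \<omega>)) * mean_sign True \<omega>)
      = (\<integral>s. expectation (\<lambda>\<omega>. (?f \<omega> * (?g \<omega> * mean_sign False \<omega>)) * sign True s \<omega>) \<partial>unit_lborel)"
    by (rule expectation_mult_mean_sign[where C="C * (C * 1)"])
       (auto simp: abs_mult f g C mean_sign_bounded simp del: mult_1_right intro!: mult_mono)
  also have "\<dots> = (\<integral>s. expectation (\<lambda>\<omega>. ?f \<omega> * sign True s \<omega>) * expectation (\<lambda>\<omega>. ?g \<omega> * mean_sign False \<omega>) \<partial>unit_lborel)"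
  proof (rule Bochner_Integration.integral_cong)
    fix s assume "s \<in> space unit_lborel"
    hence "s \<in> {0..1}" by (simp only: space_unit_lborel)
    from inner[OF this] show "expectation (\<lambda>\<omega>. (?f \<omega> * (?g \<omega> * mean_sign False \<omega>)) * sign True s \<omega>)
        = expectation (\<lambda>\<omega>. ?f \<omega> * sign True s \<omega>) * expectation (\<lambda>\<omega>. ?g \<omega> * mean_sign False \<omega>)"
      by (simp add: ac_simps)
  qed simp
  also have "\<dots> = expectation (\<lambda>\<omega>. ?f \<omega> * mean_sign True \<omega>) * expectation (\<lambda>\<omega>. ?g \<omega> * mean_sign False \<omega>)"
    by (simp add: swap_f)
  finally show ?thesis by (simp add: ac_simps)
qed

lemma expectation_mean_sign: "expectation (mean_sign c) = 0"
proof -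
  have "expectation (\<lambda>\<omega>. 1 * mean_sign c \<omega>) = (\<integral>t. expectation (\<lambda>\<omega>. 1 * sign c t \<omega>) \<partial>unit_lborel)"
    by (rule expectation_mult_mean_sign[where C=1]) auto
  also have "\<dots> = (\<integral>t. 0 \<partial>unit_lborel)"
    by (rule Bochner_Integration.integral_cong)
       (auto simp: space_unit_lborel sign_def expectation_sgn_displ)
  finally show ?thesis by simp
qed

text \<open>Fubini gives the average over t of E[a_u a_t]. Both orders of t and u lead to
  \<open>corr\<close>, and the cases t = u and t = 0 form a null set.\<close>

lemma expectation_sign_mult_mean_sign:
  assumes "0 < u" "u \<le> 1"
  shows "expectation (\<lambda>\<omega>. sign c u \<omega> * mean_sign c \<omega>) = mean_corr u"
proof -
  have u: "u \<in> {0..1}" using assms by simp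
  note [measurable] = measurable_sign[OF u] measurable_sign_joint
  have "expectation (\<lambda>\<omega>. sign c u \<omega> * mean_sign c \<omega>)
      = (\<integral>t. expectation (\<lambda>\<omega>. sign c u \<omega> * sign c t \<omega>) \<partial>unit_lborel)"
    by (rule expectation_mult_mean_sign[where C=1]) (auto simp: sign_bounded)
  also have "\<dots> = mean_corr u"
    unfolding mean_corr_def
  proof (rule integral_cong_AE)
    show "AE t in unit_lborel. expectation (\<lambda>\<omega>. sign c u \<omega> * sign c t \<omega>) = corr t u"
      using AE_unit_lborel_neq[of u] AE_unit_lborel_pos
    proof eventually_elim
      case (elim t)
      thus ?case
        using expectation_sgn_displ_mult[of t u c] expectation_sgn_displ_mult[of u t c] assms
        by (cases t u rule: linorder_cases) (auto simp: sign_def corr_def mult.commute)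
    qed
    have "(\<lambda>(t, \<omega>). sign c t \<omega>) \<in> borel_measurable (unit_lborel \<Otimes>\<^sub>M M)"
      using measurable_sign_joint by (subst measurable_pair_swap_iff) (simp add: split_beta')
    hence "(\<lambda>p. sign c u (snd p) * (case p of (t, \<omega>) \<Rightarrow> sign c t \<omega>)) \<in> borel_measurable (unit_lborel \<Otimes>\<^sub>M M)"
      by measurable
    thus "(\<lambda>t. expectation (\<lambda>\<omega>. sign c u \<omega> * sign c t \<omega>)) \<in> borel_measurable unit_lborel"
      by (intro borel_measurable_lebesgue_integral) (simp add: split_beta')
  qed (rule measurable_corr_fst)
  finally show ?thesis .
qed

text \<open>By \<open>expectation_split\<close> the two coordinates separate. In each factor the
  constant 1 contributes the mean of \<open>mean_sign\<close>, which is 0, leaving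
  \<open>a * mean_corr u\<close> and \<open>b * mean_corr u\<close>.\<close>

lemma expectation_sign_products:
  assumes "\<bar>a\<bar> = 1" "\<bar>b\<bar> = 1" "0 < u" "u \<le> 1"
  shows "expectation (\<lambda>\<omega>. mean_sign True \<omega> * mean_sign False \<omega>
      * ((1 + a * sign True u \<omega>) * (1 + b * sign False u \<omega>))) = a * b * (mean_corr u)\<^sup>2"
proof -
  have u: "u \<in> {0..1}" using assms by simp
  have one: "expectation (\<lambda>\<omega>. (1 + d * sgn (displ c u \<omega>)) * mean_sign c \<omega>) = d * mean_corr u" for c d
  proof -
    note [measurable] = measurable_sign[OF u]
    have "integrable M (mean_sign c)" "integrable M (\<lambda>\<omega>. sign c u \<omega> * mean_sign c \<omega>)"
      by (auto intro!: integrable_bounded_real[where c=1] mult_le_one simp: mean_sign_bounded sign_bounded abs_mult)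
    thus ?thesis
      using expectation_sign_mult_mean_sign[OF assms(3,4), of c]
      by (simp add: sign_def[symmetric] algebra_simps expectation_mean_sign)
  qed
  have bound: "\<bar>1 + d * sgn x\<bar> \<le> 2" if "\<bar>d\<bar> = 1" for d x :: real
    using that by (auto simp: sgn_if)
  have "expectation (\<lambda>\<omega>. ((1 + a * sgn (displ True u \<omega>)) * mean_sign True \<omega>)
      * ((1 + b * sgn (displ False u \<omega>)) * mean_sign False \<omega>)) = a * mean_corr u * (b * mean_corr u)"
    by (subst expectation_split[where C=2]) (auto simp: one bound assms less_imp_le)
  thus ?thesis by (simp add: sign_def power2_eq_square ac_simps)
qed

text \<open>Each fixed positive time is almost surely off the axes. Exchanging the two
  almost-everywhere quantifiers needs a jointly measurable set, which is why the inner step speaks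
  of \<open>sign\<close> instead of \<open>displ\<close>. At time 0 the displacement vanishes, but a
  single time is negligible.\<close>

lemma AE_off_axes:
  "AE \<omega> in M. W 0 \<omega> = 0 \<and> (\<forall>c. displ c 1 \<omega> \<noteq> 0) \<and> (AE t in unit_lborel. \<forall>c. displ c t \<omega> \<noteq> 0)"
proof -
  have all: "AE \<omega> in M. \<forall>c. displ c t \<omega> \<noteq> 0" if "0 < t" "t \<le> 1" for t
    using AE_displ_neq_0[OF that, of True] AE_displ_neq_0[OF that, of False]
    by eventually_elim (metis (full_types))
  have "AE \<omega> in M. AE t in unit_lborel. \<forall>c. sign c t \<omega> \<noteq> 0"
  proof (subst time.AE_commute)
    note [measurable] = measurable_sign_joint[of True] measurable_sign_joint[of False]
    have "{p \<in> space (M \<Otimes>\<^sub>M unit_lborel). (case p of (\<omega>, t) \<Rightarrow> sign True t \<omega>) \<noteq> 0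
        \<and> (case p of (\<omega>, t) \<Rightarrow> sign False t \<omega>) \<noteq> 0} \<in> sets (M \<Otimes>\<^sub>M unit_lborel)"
      by measurable
    also have "{p \<in> space (M \<Otimes>\<^sub>M unit_lborel). (case p of (\<omega>, t) \<Rightarrow> sign True t \<omega>) \<noteq> 0
        \<and> (case p of (\<omega>, t) \<Rightarrow> sign False t \<omega>) \<noteq> 0}
        = {p \<in> space (M \<Otimes>\<^sub>M unit_lborel). \<forall>c. sign c (snd p) (fst p) \<noteq> 0}"
      by (auto simp: split_beta' all_bool_eq)
    finally show "{p \<in> space (M \<Otimes>\<^sub>M unit_lborel). \<forall>c. sign c (snd p) (fst p) \<noteq> 0} \<in> sets (M \<Otimes>\<^sub>M unit_lborel)" .
    show "AE t in unit_lborel. AE \<omega> in M. \<forall>c. sign c t \<omega> \<noteq> 0"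
      using AE_unit_lborel_pos
      by eventually_elim (use all in \<open>auto simp: sign_def sgn_zero_iff\<close>)
  qed
  with start all[of 1] show ?thesis by (simp add: sign_def sgn_zero_iff) 
qed

lemma occupation_time_eq:
  "occupation_time W A \<omega> = (\<integral>t. indicat_real A (W t \<omega>) \<partial>unit_lborel)"
  unfolding occupation_time_def set_lebesgue_integral_def by (subst integral_restrict_space) auto

lemma measurable_indicator_quadrant_joint:
  "(\<lambda>(\<omega>, t). indicat_real (quadrant k) (W t \<omega>)) \<in> borel_measurable (M \<Otimes>\<^sub>M unit_lborel)"
proof -
  note [measurable] = measurable_W_joint
  have "(\<lambda>p. indicat_real (quadrant k) (case p of (\<omega>, t) \<Rightarrow> W t \<omega>)) \<in> borel_measurable (M \<Otimes>\<^sub>M unit_lborel)"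
    by measurable
  thus ?thesis by (simp add: split_beta')
qed

lemma measurable_indicator_quadrant_path:
  "\<omega> \<in> space M \<Longrightarrow> (\<lambda>t. indicat_real (quadrant k) (W t \<omega>)) \<in> borel_measurable unit_lborel"
  using measurable_compose[OF measurable_Pair1' measurable_indicator_quadrant_joint] by simp

lemma measurable_occupation_time: "occupation_time W (quadrant k) \<in> borel_measurable M"
  unfolding occupation_time_eq
  using measurable_indicator_quadrant_joint
  by (intro unit_lborel.borel_measurable_lebesgue_integral) simp

text \<open>The dictionary between quadrants and signs. The first two parts rewrite the two sides of
  the claimed identity; the last two rewrite A and B through the conditioning variables.\<close>

lemma AE_quadrant_signs:
  assumes k: "k \<in> {1..4}"
  shows "AE \<omega> in M. 4 * indicat_real (quadrant k) (W 1 \<omega>)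
      = (1 + x_sign k * sign True 1 \<omega>) * (1 + y_sign k * sign False 1 \<omega>)"
    and "AE \<omega> in M. 4 * occupation_time W (quadrant k) \<omega>
      = (\<integral>u. (1 + x_sign k * sign True u \<omega>) * (1 + y_sign k * sign False u \<omega>) \<partial>unit_lborel)"
    and "AE \<omega> in M. mean_sign True \<omega> = (\<Sum>i\<in>{1..4}. x_sign i * occupation_time W (quadrant i) \<omega>)"
    and "AE \<omega> in M. mean_sign False \<omega> = (\<Sum>i\<in>{1..4}. y_sign i * occupation_time W (quadrant i) \<omega>)"
proof -
  have coords: "fst (W t \<omega>) = displ True t \<omega>" "snd (W t \<omega>) = displ False t \<omega>" if "W 0 \<omega> = 0" for t \<omega>
    using that by (simp_all add: displ_def coord_def)
  show "AE \<omega> in M. 4 * indicat_real (quadrant k) (W 1 \<omega>)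
      = (1 + x_sign k * sign True 1 \<omega>) * (1 + y_sign k * sign False 1 \<omega>)"
    using AE_off_axes
    by eventually_elim (subst indicator_quadrant[OF k], auto simp: coords sign_def)
  have int: "integrable unit_lborel (\<lambda>t. indicat_real (quadrant i) (W t \<omega>))" if "\<omega> \<in> space M" for i \<omega>
    using measurable_indicator_quadrant_path[OF that]
    by (intro unit_lborel.integrable_bounded_real[where c=1]) (auto simp: indicator_def)
  have sums: "(\<Sum>i\<in>{1..4}. e i * occupation_time W (quadrant i) \<omega>)
      = (\<integral>t. (\<Sum>i\<in>{1..4}. e i * indicat_real (quadrant i) (W t \<omega>)) \<partial>unit_lborel)"
    if "\<omega> \<in> space M" for e \<omega>
    using int[OF that] by (subst Bochner_Integration.integral_sum) (auto simp: occupation_time_eq)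
  show "AE \<omega> in M. 4 * occupation_time W (quadrant k) \<omega>
      = (\<integral>u. (1 + x_sign k * sign True u \<omega>) * (1 + y_sign k * sign False u \<omega>) \<partial>unit_lborel)"
    using AE_off_axes AE_space
  proof eventually_elim
    case (elim \<omega>)
    note [measurable] = measurable_indicator_quadrant_path[OF elim(2)] measurable_sign_path[OF elim(2)]
    have "4 * occupation_time W (quadrant k) \<omega> = (\<integral>u. 4 * indicat_real (quadrant k) (W u \<omega>) \<partial>unit_lborel)"
      by (simp add: occupation_time_eq)
    also have "\<dots> = (\<integral>u. (1 + x_sign k * sign True u \<omega>) * (1 + y_sign k * sign False u \<omega>) \<partial>unit_lborel)"
    proof (rule integral_cong_AE)
      show "AE u in unit_lborel. 4 * indicat_real (quadrant k) (W u \<omega>)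
          = (1 + x_sign k * sign True u \<omega>) * (1 + y_sign k * sign False u \<omega>)"
        using elim(1)[THEN conjunct2, THEN conjunct2]
        by eventually_elim (subst indicator_quadrant[OF k], use elim(1) in \<open>auto simp: coords sign_def\<close>)
    qed measurable
    finally show ?case .
  qed
  show "AE \<omega> in M. mean_sign True \<omega> = (\<Sum>i\<in>{1..4}. x_sign i * occupation_time W (quadrant i) \<omega>)"
    using AE_off_axes AE_space
  proof eventually_elim
    case (elim \<omega>)
    note [measurable] = measurable_indicator_quadrant_path[OF elim(2)] measurable_sign_path[OF elim(2)]
    have "AE t in unit_lborel. sign True t \<omega> = (\<Sum>i\<in>{1..4}. x_sign i * indicat_real (quadrant i) (W t \<omega>))"
      using elim(1)[THEN conjunct2, THEN conjunct2]
      by eventually_elim (subst sgn_fst_eq_sum_quadrants[symmetric], use elim(1) in \<open>auto simp: coords sign_def\<close>)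
    thus ?case unfolding sums[OF elim(2)] mean_sign_def by (intro integral_cong_AE) measurable
  qed
  show "AE \<omega> in M. mean_sign False \<omega> = (\<Sum>i\<in>{1..4}. y_sign i * occupation_time W (quadrant i) \<omega>)"
    using AE_off_axes AE_space
  proof eventually_elim
    case (elim \<omega>)
    note [measurable] = measurable_indicator_quadrant_path[OF elim(2)] measurable_sign_path[OF elim(2)]
    have "AE t in unit_lborel. sign False t \<omega> = (\<Sum>i\<in>{1..4}. y_sign i * indicat_real (quadrant i) (W t \<omega>))"
      using elim(1)[THEN conjunct2, THEN conjunct2]
      by eventually_elim (subst sgn_snd_eq_sum_quadrants[symmetric], use elim(1) in \<open>auto simp: coords sign_def\<close>)
    thus ?case unfolding sums[OF elim(2)] mean_sign_def by (intro integral_cong_AE) measurable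
  qed
qed

end

section \<open>The conditioning sigma-algebra and the contradiction\<close>

lemma space_generated_algebra: "space (generated_algebra M I X) = space M"
  unfolding generated_algebra_def by (rule space_measure_of) auto

lemma measurable_generated_algebra:
  assumes "i \<in> I"
  shows "X i \<in> borel_measurable (generated_algebra M I X)"
proof (rule measurableI)
  fix B assume "B \<in> sets (borel :: real measure)"
  thus "X i -` B \<inter> space (generated_algebra M I X) \<in> sets (generated_algebra M I X)"
    unfolding space_generated_algebra unfolding generated_algebra_def
    using assms by (intro in_measure_of) auto
qed simp

lemma subalgebra_generated_algebra:
  assumes "\<And>i. i \<in> I \<Longrightarrow> X i \<in> borel_measurable M"
  shows "subalgebra M (generated_algebra M I X)"
proof -
  have "{X i -` B \<inter> space M |i B. i \<in> I \<and> B \<in> sets borel} \<subseteq> sets M"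
    using assms by (auto intro: measurable_sets)
  thus ?thesis
    unfolding subalgebra_def space_generated_algebra
    by (auto simp: generated_algebra_def sets_measure_of_conv dest: sets.sigma_sets_subset)
qed

context planar_brownian_motion
begin

interpretation time: pair_prob_space M unit_lborel ..

lemma cond_prob_quadrant_not_AE_occupation_time:
  assumes k: "k \<in> {1..4}"
  shows "\<not> (AE \<omega> in M. cond_prob_event M
      (generated_algebra M {1..4} (\<lambda>i. occupation_time W (quadrant i)))
      {\<omega> \<in> space M. W 1 \<omega> \<in> quadrant k} \<omega>
    = occupation_time W (quadrant k) \<omega>)"
proof
  define F where "F = generated_algebra M {1..4} (\<lambda>i. occupation_time W (quadrant i))"
  define S where "S = {\<omega> \<in> space M. W 1 \<omega> \<in> quadrant k}"
  \<comment> \<open>A version of AB written in occupation times, so that it is measurable for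
    \<open>F\<close> itself. The product \<open>P\<close> agrees with it only almost surely, and
    \<open>F\<close> is not completed by null sets.\<close>
  define T where "T \<omega> = (\<Sum>i\<in>{1..4}. x_sign i * occupation_time W (quadrant i) \<omega>)
    * (\<Sum>i\<in>{1..4}. y_sign i * occupation_time W (quadrant i) \<omega>)" for \<omega>
  define \<phi> where "\<phi> u \<omega> = (1 + x_sign k * sign True u \<omega>) * (1 + y_sign k * sign False u \<omega>)" for u \<omega>
  define P where "P \<omega> = mean_sign True \<omega> * mean_sign False \<omega>" for \<omega>
  assume "AE \<omega> in M. cond_prob_event M
      (generated_algebra M {1..4} (\<lambda>i. occupation_time W (quadrant i)))
      {\<omega> \<in> space M. W 1 \<omega> \<in> quadrant k} \<omega>
    = occupation_time W (quadrant k) \<omega>"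
  hence cond: "AE \<omega> in M. real_cond_exp M F (indicat_real S) \<omega> = occupation_time W (quadrant k) \<omega>"
    by (simp add: cond_prob_event_def F_def S_def)
  note [measurable] = measurable_occupation_time measurable_sign_joint
  have W1 [measurable]: "W 1 \<in> borel_measurable M" by (rule measurable_W) simp
  have S [measurable]: "S \<in> sets M" unfolding S_def by measurable
  have sub: "subalgebra M F"
    unfolding F_def by (rule subalgebra_generated_algebra) measurable
  interpret F: finite_measure_subalgebra M F
    by unfold_locales (rule sub)
  have signs: "\<bar>x_sign k\<bar> = 1" "\<bar>y_sign k\<bar> = 1"
    by (auto simp: x_sign_def y_sign_def)
  have \<phi>_bound: "\<bar>\<phi> u \<omega>\<bar> \<le> 4" for u \<omega>
  proof -
    have "\<bar>1 + a * b\<bar> \<le> 2" if "\<bar>a\<bar> = 1" "\<bar>b\<bar> \<le> 1" for a b :: real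
      using that by (auto simp: abs_if split: if_splits)
    from mult_mono[OF this[OF signs(1) sign_bounded] this[OF signs(2) sign_bounded]]
    show ?thesis by (simp add: \<phi>_def abs_mult)
  qed
  have P_meas [measurable]: "P \<in> borel_measurable M"
    unfolding P_def by measurable
  have P_bound: "\<bar>P \<omega>\<bar> \<le> 1" if "\<omega> \<in> space M" for \<omega>
    using that unfolding P_def abs_mult by (intro mult_le_one mean_sign_bounded) auto
  have T_eq: "AE \<omega> in M. T \<omega> = P \<omega>"
    using AE_quadrant_signs(3,4)[OF k] by eventually_elim (simp add: T_def P_def)
  have T_F: "T \<in> borel_measurable F"
    unfolding T_def F_def
    by (intro borel_measurable_times borel_measurable_sum borel_measurable_const measurable_generated_algebra)
  have T_M [measurable]: "T \<in> borel_measurable M"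
    unfolding T_def by measurable
  have ind_eq: "AE \<omega> in M. 4 * indicat_real S \<omega> = \<phi> 1 \<omega>"
    using AE_quadrant_signs(1)[OF k] AE_space
    by eventually_elim (auto simp: S_def \<phi>_def indicator_def)
  have \<phi>_meas [measurable]: "\<phi> u \<in> borel_measurable M" if "u \<in> {0..1}" for u
    using measurable_sign[OF that] unfolding \<phi>_def by measurable
  have \<phi>_joint: "(\<lambda>(\<omega>, u). P \<omega> * \<phi> u \<omega>) \<in> borel_measurable (M \<Otimes>\<^sub>M unit_lborel)"
  proof -
    have "(\<lambda>p. P (fst p) * ((1 + x_sign k * (case p of (\<omega>, t) \<Rightarrow> sign True t \<omega>))
        * (1 + y_sign k * (case p of (\<omega>, t) \<Rightarrow> sign False t \<omega>)))) \<in> borel_measurable (M \<Otimes>\<^sub>M unit_lborel)"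
      by measurable
    thus ?thesis by (simp add: \<phi>_def split_beta')
  qed
  \<comment> \<open>The defining property of conditional expectation, tested against the bounded
    \<open>F\<close>-measurable \<open>T\<close>.\<close>
  have "expectation (\<lambda>\<omega>. T \<omega> * real_cond_exp M F (indicat_real S) \<omega>) = expectation (\<lambda>\<omega>. T \<omega> * indicat_real S \<omega>)"
  proof (rule F.real_cond_exp_intg)
    have "AE \<omega> in M. norm (T \<omega> * indicat_real S \<omega>) \<le> 1"
      using T_eq AE_space by eventually_elim (use P_bound in \<open>auto simp: indicator_def\<close>)
    thus "integrable M (\<lambda>\<omega>. T \<omega> * indicat_real S \<omega>)"
      by (intro integrable_const_bound[where B=1]) auto
  qed (use T_F in auto)
  moreover have "expectation (\<lambda>\<omega>. T \<omega> * real_cond_exp M F (indicat_real S) \<omega>)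
      = expectation (\<lambda>\<omega>. T \<omega> * occupation_time W (quadrant k) \<omega>)"
    using cond by (intro integral_cong_AE) (auto elim: eventually_mono)
  ultimately have "4 * expectation (\<lambda>\<omega>. T \<omega> * indicat_real S \<omega>)
      = 4 * expectation (\<lambda>\<omega>. T \<omega> * occupation_time W (quadrant k) \<omega>)"
    by simp
  hence eq: "expectation (\<lambda>\<omega>. T \<omega> * (4 * indicat_real S \<omega>))
      = expectation (\<lambda>\<omega>. T \<omega> * (4 * occupation_time W (quadrant k) \<omega>))"
    by (simp add: mult.left_commute[of _ 4])
  have "expectation (\<lambda>\<omega>. T \<omega> * (4 * indicat_real S \<omega>)) = expectation (\<lambda>\<omega>. P \<omega> * \<phi> 1 \<omega>)"
  proof (rule integral_cong_AE)
    show "AE \<omega> in M. T \<omega> * (4 * indicat_real S \<omega>) = P \<omega> * \<phi> 1 \<omega>"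
      using T_eq ind_eq by eventually_elim (simp only:)
  qed measurable
  also have "\<dots> = x_sign k * y_sign k * (mean_corr 1)\<^sup>2"
    unfolding P_def \<phi>_def by (rule expectation_sign_products) (use signs in auto)
  finally have end_val: "expectation (\<lambda>\<omega>. T \<omega> * (4 * indicat_real S \<omega>)) = x_sign k * y_sign k * (mean_corr 1)\<^sup>2" .
  have "expectation (\<lambda>\<omega>. T \<omega> * (4 * occupation_time W (quadrant k) \<omega>))
      = expectation (\<lambda>\<omega>. \<integral>u. P \<omega> * \<phi> u \<omega> \<partial>unit_lborel)"
  proof (rule integral_cong_AE)
    show "AE \<omega> in M. T \<omega> * (4 * occupation_time W (quadrant k) \<omega>) = (\<integral>u. P \<omega> * \<phi> u \<omega> \<partial>unit_lborel)"
      using T_eq AE_quadrant_signs(2)[OF k] by eventually_elim (simp add: \<phi>_def)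
    show "(\<lambda>\<omega>. \<integral>u. P \<omega> * \<phi> u \<omega> \<partial>unit_lborel) \<in> borel_measurable M"
      using \<phi>_joint by (intro unit_lborel.borel_measurable_lebesgue_integral) simp
  qed measurable
  also have "\<dots> = (\<integral>u. expectation (\<lambda>\<omega>. P \<omega> * \<phi> u \<omega>) \<partial>unit_lborel)"
  proof (rule time.Fubini_integral[symmetric], rule time.integrable_bounded_real[where c="1 * 4"])
    fix p assume "p \<in> space (M \<Otimes>\<^sub>M unit_lborel)"
    thus "\<bar>case p of (\<omega>, u) \<Rightarrow> P \<omega> * \<phi> u \<omega>\<bar> \<le> 1 * 4"
      unfolding split_beta' abs_mult
      by (intro mult_mono P_bound \<phi>_bound) (auto simp: space_pair_measure)
  qed (rule \<phi>_joint)
  \<comment> \<open>Time 0 is left out because \<open>expectation_sign_products\<close> requires a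
    positive time.\<close>
  also have "\<dots> = (\<integral>u. x_sign k * y_sign k * (mean_corr u)\<^sup>2 \<partial>unit_lborel)"
  proof (rule integral_cong_AE)
    show "AE u in unit_lborel. expectation (\<lambda>\<omega>. P \<omega> * \<phi> u \<omega>) = x_sign k * y_sign k * (mean_corr u)\<^sup>2"
      using AE_unit_lborel_pos
      by eventually_elim (simp add: P_def \<phi>_def expectation_sign_products signs)
    have "(\<lambda>(u, \<omega>). P \<omega> * \<phi> u \<omega>) \<in> borel_measurable (unit_lborel \<Otimes>\<^sub>M M)"
      using \<phi>_joint by (subst measurable_pair_swap_iff) (simp add: split_beta')
    thus "(\<lambda>u. expectation (\<lambda>\<omega>. P \<omega> * \<phi> u \<omega>)) \<in> borel_measurable unit_lborel"
      by (intro borel_measurable_lebesgue_integral) simp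
  qed (use measurable_mean_corr in measurable)
  finally have "x_sign k * y_sign k * (mean_corr 1)\<^sup>2
      = x_sign k * y_sign k * (\<integral>u. (mean_corr u)\<^sup>2 \<partial>unit_lborel)"
    using eq end_val by simp
  \<comment> \<open>The common factor \<open>x_sign k * y_sign k\<close> is 1 or -1 and cancels, so
    the quadrant no longer matters.\<close>
  hence "(\<integral>u. (mean_corr u)\<^sup>2 \<partial>unit_lborel) = (mean_corr 1)\<^sup>2"
    using signs by auto
  thus False using integral_mean_corr_square_neq by contradiction
qed

end

theorem proposition4p1:
  fixes M :: "'w measure" and W :: "real \<Rightarrow> 'w \<Rightarrow> real \<times> real"
  assumes "brownian_motion M W"
  shows "\<forall>k\<in>{1..4}. \<not> (AE \<omega> in M.
    cond_prob_event M
      (generated_algebra M {1..4} (\<lambda>i. occupation_time W (quadrant i)))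
      {\<omega> \<in> space M. W 1 \<omega> \<in> quadrant k} \<omega>
    = occupation_time W (quadrant k) \<omega>)"
proof -
  interpret planar_brownian_motion M W
    using assms by (simp add: planar_brownian_motion_def)
  show ?thesis using cond_prob_quadrant_not_AE_occupation_time by blast
qed

end
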